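(* Let $\mathbf T_5=(\mathcal P(X),\cup,\varnothing;\mathcal P(X),\cup,\varnothing;H_5^{\#})$ be the powerset complex of the diagonal core $(X,X,H_5)$. The algebra $\mathbf T_5$ is an atom-total, completely additive complete atomic Boolean ternary $\Gamma$-semiring. It has exactly $36$ strong atom-saturated congruence pairs. Its eight diagonal strong atom-saturated congruences form (under inclusion) the Boolean lattice $B_3$ with three atoms. The algebra has no atomic binary collapse, but every quotient by a proper diagonal strong atom-saturated congruence has one. Up to isomorphism, these proper diagonal quotients have five types, corresponding to the following isomorphism types of quotients of $H_5$: $$H_5/\nabla,\quad H_5/\alpha\cong H_5/\beta,\quad H_5/\pi,\quad H_5/\lambda\cong H_5/\mu,\quad H_5/\nu.$$
   Context: Ternary $\Gamma$-semiring: additive commutative semigroups $(S,+)$, $(\Gamma,+)$ and a map $S\times\Gamma\times S\times\Gamma\times S\to S$, $(x,\alpha,y,\beta,z)\mapsto x\alpha y\beta z$, distributive in the three carrier ($S$) coordinates, with $(x\alpha y\beta z)\gamma u\delta v=x\alpha(y\beta z\gamma u)\delta v=x\alpha y\beta(z\gamma u\delta v)$. It is completely additive if both reducts are complete lattices with addition equal to join and the product preserves arbitrary joins in all five coordinates. It is complete atomic Boolean if both reducts are complete atomic Boolean lattices. It is atom-total if every product of three carrier atoms and two index atoms is a carrier atom. The core: $X=\{1,2,3,4\}$, $\epsilon:X\to\mathbb Z_2$ with $\epsilon(1)=\epsilon(4)=0$, $\epsilon(2)=\epsilon(3)=1$, $\eta(0)=4$, $\eta(1)=3$; $H_5(x_1,\dots,x_5)=1$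 if all $x_i=1$; $=2$ if all $x_i=2$; and $=\eta(\epsilon(x_1)+\dots+\epsilon(x_5))$ otherwise (sum in $\mathbb Z_2$). Positions $1,3,5$ are carrier entries and positions $2,4$ are index entries, both sorts being $X$. For $A,B,C,D,E\subseteq X$, $$H_5^{\#}[A,B,C,D,E]=\{H_5(a,b,c,d,e):a\in A,b\in B,c\in C,d\in D,e\in E\}.$$ For an equivalence $\theta$ on $X$ and $A,A'\subseteq X$, $A\equiv_\theta A'$ means $\{[a]_\theta:a\in A\}=\{[a']_\theta:a'\in A'\}$. A congruence pair of the powerset complex is atom-saturated if it has the form $(\equiv_\theta,\equiv_\phi)$ for equivalences $\theta,\phi$ on the carrier and index atoms. It is strong if $(\theta,\phi)$ is a strong frame congruence of the core, which for a functional core $Q$ means: $x_i\mathrel\theta x_i'$ ($i=1,2,3$) and $\lambda_j\mathrel\phi\lambda_j'$ ($j=1,2$) imply $Q(x_1,\lambda_1,x_2,\lambda_2,x_3)\mathrel\theta Q(x_1',\lambda_1',x_2',\lambda_2',x_3')$. It is diagonal if $\theta=\phi$; a diagonal one is called proper here if $\theta$ is not the identity relation. The quotient by $(\equiv_\theta,\equiv_\theta)$ is (isomorphic to) the powerset complex of the quotient core $H_5/\theta$ on $X/\theta$, so its carrier and index lattices are $\mathcal P(X/\theta)$. For an associative operation $Q:Y^5\to Y$ with setwise extension $Q^{\#}$ on $\mathcal P(Y)$, an atomic binary collapse of its powerset complex is an associative, arbitrary-union-preserving (in each argument) binary operation $\star$ on $\mathcal P(Y)$ that sends pairs of singletons to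 singletons and satisfies $A\star B\star C\star D\star E=Q^{\#}[A,B,C,D,E]$ for all $A,\dots,E\subseteq Y$. The named equivalences on $X$ (blocks separated by bars): $\lambda=1|23|4$, $\mu=14|2|3$, $\nu=1|2|34$, $\alpha=134|2$, $\pi=14|23$, $\beta=1|234$, $\nabla=1234$. *)

theory Defs
  imports "HOL-Algebra.Complete_Lattice" "HOL-Library.Z2"
begin

section \<open>Lattice notions missing from HOL-Algebra\<close>

definition is_atom :: "('a, 'b) gorder_scheme \<Rightarrow> 'a \<Rightarrow> bool" where
  "is_atom L a \<longleftrightarrow> a \<in> carrier L \<and> a \<noteq> \<bottom>\<^bsub>L\<^esub> \<and>
     (\<forall>x\<in>carrier L. x \<sqsubseteq>\<^bsub>L\<^esub> a \<longrightarrow> x = \<bottom>\<^bsub>L\<^esub> \<or> x = a)"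

definition complete_atomic_boolean_lattice :: "('a, 'b) gorder_scheme \<Rightarrow> bool" where
  "complete_atomic_boolean_lattice L \<longleftrightarrow> complete_lattice L \<and>
     (\<forall>x\<in>carrier L. \<forall>y\<in>carrier L. \<forall>z\<in>carrier L.
        x \<sqinter>\<^bsub>L\<^esub> (y \<squnion>\<^bsub>L\<^esub> z) = (x \<sqinter>\<^bsub>L\<^esub> y) \<squnion>\<^bsub>L\<^esub> (x \<sqinter>\<^bsub>L\<^esub> z)) \<and>
     (\<forall>x\<in>carrier L. \<exists>y\<in>carrier L. x \<sqinter>\<^bsub>L\<^esub> y = \<bottom>\<^bsub>L\<^esub> \<and> x \<squnion>\<^bsub>L\<^esub> y = \<top>\<^bsub>L\<^esub>) \<and>
     (\<forall>x\<in>carrier L. x \<noteq> \<bottom>\<^bsub>L\<^esub> \<longrightarrow> (\<exists>a. is_atom L a \<and> a \<sqsubseteq>\<^bsub>L\<^esub> x))"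

section \<open>Ternary Gamma-semirings\<close>

record ('s, 'g) tgs =
  scarrier :: "'s set"
  gcarrier :: "'g set"
  sadd :: "'s \<Rightarrow> 's \<Rightarrow> 's"
  gadd :: "'g \<Rightarrow> 'g \<Rightarrow> 'g"
  tprod :: "'s \<Rightarrow> 'g \<Rightarrow> 's \<Rightarrow> 'g \<Rightarrow> 's \<Rightarrow> 's"

definition comm_semigroup_on :: "'a set \<Rightarrow> ('a \<Rightarrow> 'a \<Rightarrow> 'a) \<Rightarrow> bool" where
  "comm_semigroup_on A f \<longleftrightarrow>
     (\<forall>x\<in>A. \<forall>y\<in>A. f x y \<in> A) \<and>
     (\<forall>x\<in>A. \<forall>y\<in>A. \<forall>z\<in>A. f (f x y) z = f x (f y z)) \<and>
     (\<forall>x\<in>A. \<forall>y\<in>A. f x y = f y x)"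

locale ternary_gamma_semiring =
  fixes T :: "('s, 'g) tgs"
  assumes add_S: "comm_semigroup_on (scarrier T) (sadd T)"
    and add_G: "comm_semigroup_on (gcarrier T) (gadd T)"
    and closed:
      "\<lbrakk>x \<in> scarrier T; a \<in> gcarrier T; y \<in> scarrier T; b \<in> gcarrier T; z \<in> scarrier T\<rbrakk>
        \<Longrightarrow> tprod T x a y b z \<in> scarrier T"
    and distrib1:
      "\<lbrakk>x \<in> scarrier T; x' \<in> scarrier T; a \<in> gcarrier T; y \<in> scarrier T; b \<in> gcarrier T;
        z \<in> scarrier T\<rbrakk>
        \<Longrightarrow> tprod T (sadd T x x') a y b z = sadd T (tprod T x a y b z) (tprod T x' a y b z)"
    and distrib3:
      "\<lbrakk>x \<in> scarrier T; a \<in> gcarrier T; y \<in> scarrier T; y' \<in> scarrier T; b \<in> gcarrier T;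
        z \<in> scarrier T\<rbrakk>
        \<Longrightarrow> tprod T x a (sadd T y y') b z = sadd T (tprod T x a y b z) (tprod T x a y' b z)"
    and distrib5:
      "\<lbrakk>x \<in> scarrier T; a \<in> gcarrier T; y \<in> scarrier T; b \<in> gcarrier T; z \<in> scarrier T;
        z' \<in> scarrier T\<rbrakk>
        \<Longrightarrow> tprod T x a y b (sadd T z z') = sadd T (tprod T x a y b z) (tprod T x a y b z')"
    and assoc_left:
      "\<lbrakk>x \<in> scarrier T; a \<in> gcarrier T; y \<in> scarrier T; b \<in> gcarrier T; z \<in> scarrier T;
        c \<in> gcarrier T; u \<in> scarrier T; d \<in> gcarrier T; v \<in> scarrier T\<rbrakk>
        \<Longrightarrow> tprod T (tprod T x a y b z) c u d v = tprod T x a (tprod T y b z c u) d v"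
    and assoc_right:
      "\<lbrakk>x \<in> scarrier T; a \<in> gcarrier T; y \<in> scarrier T; b \<in> gcarrier T; z \<in> scarrier T;
        c \<in> gcarrier T; u \<in> scarrier T; d \<in> gcarrier T; v \<in> scarrier T\<rbrakk>
        \<Longrightarrow> tprod T x a (tprod T y b z c u) d v = tprod T x a y b (tprod T z c u d v)"

text \<open>The order of a reduct is the one determined by its addition; \<open>add_complete\<close> then says that it
  is a complete lattice whose binary join is the addition.\<close>

definition add_order :: "'a set \<Rightarrow> ('a \<Rightarrow> 'a \<Rightarrow> 'a) \<Rightarrow> 'a gorder" where
  "add_order A f = \<lparr>carrier = A, eq = (=), le = (\<lambda>x y. f x y = y)\<rparr>"

definition add_complete :: "'a set \<Rightarrow> ('a \<Rightarrow> 'a \<Rightarrow> 'a) \<Rightarrow> bool" where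
  "add_complete A f \<longleftrightarrow> complete_lattice (add_order A f) \<and>
     (\<forall>x\<in>A. \<forall>y\<in>A. f x y = x \<squnion>\<^bsub>add_order A f\<^esub> y)"

abbreviation S_lattice :: "('s, 'g) tgs \<Rightarrow> 's gorder" where
  "S_lattice T \<equiv> add_order (scarrier T) (sadd T)"

abbreviation G_lattice :: "('s, 'g) tgs \<Rightarrow> 'g gorder" where
  "G_lattice T \<equiv> add_order (gcarrier T) (gadd T)"

text \<open>Arbitrary joins include the empty one.\<close>

definition sup_preserving :: "('a, 'c) gorder_scheme \<Rightarrow> ('b, 'd) gorder_scheme \<Rightarrow> ('a \<Rightarrow> 'b) \<Rightarrow> bool" where
  "sup_preserving L M h \<longleftrightarrow> (\<forall>A\<subseteq>carrier L. h (\<Squnion>\<^bsub>L\<^esub>A) = \<Squnion>\<^bsub>M\<^esub>(h ` A))"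

definition completely_additive :: "('s, 'g) tgs \<Rightarrow> bool" where
  "completely_additive T \<longleftrightarrow>
     add_complete (scarrier T) (sadd T) \<and> add_complete (gcarrier T) (gadd T) \<and>
     (\<forall>x\<in>scarrier T. \<forall>a\<in>gcarrier T. \<forall>y\<in>scarrier T. \<forall>b\<in>gcarrier T. \<forall>z\<in>scarrier T.
        sup_preserving (S_lattice T) (S_lattice T) (\<lambda>t. tprod T t a y b z) \<and>
        sup_preserving (G_lattice T) (S_lattice T) (\<lambda>t. tprod T x t y b z) \<and>
        sup_preserving (S_lattice T) (S_lattice T) (\<lambda>t. tprod T x a t b z) \<and>
        sup_preserving (G_lattice T) (S_lattice T) (\<lambda>t. tprod T x a y t z) \<and>
        sup_preserving (S_lattice T) (S_lattice T) (\<lambda>t. tprod T x a y b t))"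

definition complete_atomic_boolean :: "('s, 'g) tgs \<Rightarrow> bool" where
  "complete_atomic_boolean T \<longleftrightarrow>
     complete_atomic_boolean_lattice (S_lattice T) \<and> complete_atomic_boolean_lattice (G_lattice T)"

definition atom_total :: "('s, 'g) tgs \<Rightarrow> bool" where
  "atom_total T \<longleftrightarrow>
     (\<forall>x a y b z. is_atom (S_lattice T) x \<longrightarrow> is_atom (G_lattice T) a \<longrightarrow>
        is_atom (S_lattice T) y \<longrightarrow> is_atom (G_lattice T) b \<longrightarrow> is_atom (S_lattice T) z \<longrightarrow>
        is_atom (S_lattice T) (tprod T x a y b z))"

definition congruence_pair :: "('s, 'g) tgs \<Rightarrow> ('s \<times> 's) set \<Rightarrow> ('g \<times> 'g) set \<Rightarrow> bool" where
  "congruence_pair T R G \<longleftrightarrow>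
     equiv (scarrier T) R \<and> equiv (gcarrier T) G \<and>
     (\<forall>(x, x')\<in>R. \<forall>(y, y')\<in>R. (sadd T x y, sadd T x' y') \<in> R) \<and>
     (\<forall>(a, a')\<in>G. \<forall>(b, b')\<in>G. (gadd T a b, gadd T a' b') \<in> G) \<and>
     (\<forall>(x, x')\<in>R. \<forall>(a, a')\<in>G. \<forall>(y, y')\<in>R. \<forall>(b, b')\<in>G. \<forall>(z, z')\<in>R.
        (tprod T x a y b z, tprod T x' a' y' b' z') \<in> R)"

text \<open>For a congruence, the classes united in each operation below all coincide.\<close>

definition tgs_quotient ::
    "('s, 'g) tgs \<Rightarrow> ('s \<times> 's) set \<Rightarrow> ('g \<times> 'g) set \<Rightarrow> ('s set, 'g set) tgs" where
  "tgs_quotient T R G =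
     \<lparr>scarrier = scarrier T // R,
      gcarrier = gcarrier T // G,
      sadd = (\<lambda>A B. \<Union>a\<in>A. \<Union>b\<in>B. R `` {sadd T a b}),
      gadd = (\<lambda>A B. \<Union>a\<in>A. \<Union>b\<in>B. G `` {gadd T a b}),
      tprod = (\<lambda>A B C D E.
        \<Union>a\<in>A. \<Union>b\<in>B. \<Union>c\<in>C. \<Union>d\<in>D. \<Union>e\<in>E. R `` {tprod T a b c d e})\<rparr>"

definition tgs_iso ::
    "('s \<Rightarrow> 't) \<Rightarrow> ('g \<Rightarrow> 'h) \<Rightarrow> ('s, 'g) tgs \<Rightarrow> ('t, 'h) tgs \<Rightarrow> bool" where
  "tgs_iso f g T U \<longleftrightarrow>
     bij_betw f (scarrier T) (scarrier U) \<and> bij_betw g (gcarrier T) (gcarrier U) \<and>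
     (\<forall>x\<in>scarrier T. \<forall>y\<in>scarrier T. f (sadd T x y) = sadd U (f x) (f y)) \<and>
     (\<forall>a\<in>gcarrier T. \<forall>b\<in>gcarrier T. g (gadd T a b) = gadd U (g a) (g b)) \<and>
     (\<forall>x\<in>scarrier T. \<forall>a\<in>gcarrier T. \<forall>y\<in>scarrier T. \<forall>b\<in>gcarrier T. \<forall>z\<in>scarrier T.
        f (tprod T x a y b z) = tprod U (f x) (g a) (f y) (g b) (f z))"

definition tgs_isomorphic :: "('s, 'g) tgs \<Rightarrow> ('t, 'h) tgs \<Rightarrow> bool" where
  "tgs_isomorphic T U \<longleftrightarrow> (\<exists>f g. tgs_iso f g T U)"

section \<open>Functional cores and their powerset complexes\<close>

definition setwise ::
    "('a \<Rightarrow> 'b \<Rightarrow> 'a \<Rightarrow> 'b \<Rightarrow> 'a \<Rightarrow> 'a) \<Rightarrow> 'a set \<Rightarrow> 'b set \<Rightarrow> 'a set \<Rightarrow> 'b set \<Rightarrow> 'a set \<Rightarrow> 'a set" where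
  "setwise Q A B C D E = {Q a b c d e |a b c d e. a \<in> A \<and> b \<in> B \<and> c \<in> C \<and> d \<in> D \<and> e \<in> E}"

text \<open>The constant \<open>{}\<close> of the two reducts is their empty join and is not a separate field.\<close>

definition powerset_complex ::
    "'a set \<Rightarrow> 'b set \<Rightarrow> ('a \<Rightarrow> 'b \<Rightarrow> 'a \<Rightarrow> 'b \<Rightarrow> 'a \<Rightarrow> 'a) \<Rightarrow> ('a set, 'b set) tgs" where
  "powerset_complex Y L Q =
     \<lparr>scarrier = Pow Y, gcarrier = Pow L, sadd = (\<union>), gadd = (\<union>), tprod = setwise Q\<rparr>"

text \<open>For a set \<open>A\<close> of elements, \<open>A // \<theta>\<close> is the set of classes met by \<open>A\<close>.\<close>

definition saturated :: "'a set \<Rightarrow> ('a \<times> 'a) set \<Rightarrow> ('a set \<times> 'a set) set" where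
  "saturated Y \<theta> = {(A, A'). A \<subseteq> Y \<and> A' \<subseteq> Y \<and> A // \<theta> = A' // \<theta>}"

definition strong_frame_congruence ::
    "'a set \<Rightarrow> 'b set \<Rightarrow> ('a \<Rightarrow> 'b \<Rightarrow> 'a \<Rightarrow> 'b \<Rightarrow> 'a \<Rightarrow> 'a) \<Rightarrow> ('a \<times> 'a) set \<Rightarrow> ('b \<times> 'b) set \<Rightarrow> bool" where
  "strong_frame_congruence Y L Q \<theta> \<phi> \<longleftrightarrow> equiv Y \<theta> \<and> equiv L \<phi> \<and>
     (\<forall>(x, x')\<in>\<theta>. \<forall>(a, a')\<in>\<phi>. \<forall>(y, y')\<in>\<theta>. \<forall>(b, b')\<in>\<phi>. \<forall>(z, z')\<in>\<theta>.
        (Q x a y b z, Q x' a' y' b' z') \<in> \<theta>)"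

definition induces_strong ::
    "'a set \<Rightarrow> 'b set \<Rightarrow> ('a \<Rightarrow> 'b \<Rightarrow> 'a \<Rightarrow> 'b \<Rightarrow> 'a \<Rightarrow> 'a) \<Rightarrow> ('a \<times> 'a) set \<Rightarrow> ('b \<times> 'b) set \<Rightarrow> bool" where
  "induces_strong Y L Q \<theta> \<phi> \<longleftrightarrow> strong_frame_congruence Y L Q \<theta> \<phi> \<and>
     congruence_pair (powerset_complex Y L Q) (saturated Y \<theta>) (saturated L \<phi>)"

definition strong_atom_saturated_pairs ::
    "'a set \<Rightarrow> 'b set \<Rightarrow> ('a \<Rightarrow> 'b \<Rightarrow> 'a \<Rightarrow> 'b \<Rightarrow> 'a \<Rightarrow> 'a) \<Rightarrow>
     (('a set \<times> 'a set) set \<times> ('b set \<times> 'b set) set) set" where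
  "strong_atom_saturated_pairs Y L Q =
     {(saturated Y \<theta>, saturated L \<phi>) |\<theta> \<phi>. induces_strong Y L Q \<theta> \<phi>}"

definition diagonal_pairs ::
    "'a set \<Rightarrow> ('a \<Rightarrow> 'a \<Rightarrow> 'a \<Rightarrow> 'a \<Rightarrow> 'a \<Rightarrow> 'a) \<Rightarrow>
     (('a set \<times> 'a set) set \<times> ('a set \<times> 'a set) set) set" where
  "diagonal_pairs Y Q = {(saturated Y \<theta>, saturated Y \<theta>) |\<theta>. induces_strong Y Y Q \<theta> \<theta>}"

definition pair_inclusion_order ::
    "('p set \<times> 'q set) set \<Rightarrow> ('p set \<times> 'q set) gorder" where
  "pair_inclusion_order D =
     \<lparr>carrier = D, eq = (=), le = (\<lambda>c d. fst c \<subseteq> fst d \<and> snd c \<subseteq> snd d)\<rparr>"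

definition proper_diagonal ::
    "'a set \<Rightarrow> ('a \<Rightarrow> 'a \<Rightarrow> 'a \<Rightarrow> 'a \<Rightarrow> 'a \<Rightarrow> 'a) \<Rightarrow> ('a \<times> 'a) set set" where
  "proper_diagonal Y Q = {\<theta>. induces_strong Y Y Q \<theta> \<theta> \<and> \<theta> \<noteq> Id_on Y}"

definition diagonal_quotient ::
    "'a set \<Rightarrow> ('a \<Rightarrow> 'a \<Rightarrow> 'a \<Rightarrow> 'a \<Rightarrow> 'a \<Rightarrow> 'a) \<Rightarrow> ('a \<times> 'a) set \<Rightarrow> ('a set set, 'a set set) tgs" where
  "diagonal_quotient Y Q \<theta> =
     tgs_quotient (powerset_complex Y Y Q) (saturated Y \<theta>) (saturated Y \<theta>)"

definition core_quotient ::
    "('a \<Rightarrow> 'a \<Rightarrow> 'a \<Rightarrow> 'a \<Rightarrow> 'a \<Rightarrow> 'a) \<Rightarrow> ('a \<times> 'a) set \<Rightarrow>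
     'a set \<Rightarrow> 'a set \<Rightarrow> 'a set \<Rightarrow> 'a set \<Rightarrow> 'a set \<Rightarrow> 'a set" where
  "core_quotient Q \<theta> A B C D E =
     (\<Union>a\<in>A. \<Union>b\<in>B. \<Union>c\<in>C. \<Union>d\<in>D. \<Union>e\<in>E. \<theta> `` {Q a b c d e})"

definition core_isomorphic ::
    "'a set \<Rightarrow> ('a \<Rightarrow> 'a \<Rightarrow> 'a \<Rightarrow> 'a \<Rightarrow> 'a \<Rightarrow> 'a) \<Rightarrow>
     'b set \<Rightarrow> ('b \<Rightarrow> 'b \<Rightarrow> 'b \<Rightarrow> 'b \<Rightarrow> 'b \<Rightarrow> 'b) \<Rightarrow> bool" where
  "core_isomorphic Y Q Z P \<longleftrightarrow>
     (\<exists>h. bij_betw h Y Z \<and>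
        (\<forall>a\<in>Y. \<forall>b\<in>Y. \<forall>c\<in>Y. \<forall>d\<in>Y. \<forall>e\<in>Y. h (Q a b c d e) = P (h a) (h b) (h c) (h d) (h e)))"

definition atomic_binary_collapse ::
    "'a set \<Rightarrow> ('a \<Rightarrow> 'a \<Rightarrow> 'a \<Rightarrow> 'a \<Rightarrow> 'a \<Rightarrow> 'a) \<Rightarrow> ('a set \<Rightarrow> 'a set \<Rightarrow> 'a set) \<Rightarrow> bool" where
  "atomic_binary_collapse Y Q s \<longleftrightarrow>
     (\<forall>A\<subseteq>Y. \<forall>B\<subseteq>Y. s A B \<subseteq> Y) \<and>
     (\<forall>A\<subseteq>Y. \<forall>B\<subseteq>Y. \<forall>C\<subseteq>Y. s (s A B) C = s A (s B C)) \<and>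
     (\<forall>F\<subseteq>Pow Y. \<forall>B\<subseteq>Y. s (\<Union>F) B = (\<Union>A\<in>F. s A B) \<and> s B (\<Union>F) = (\<Union>A\<in>F. s B A)) \<and>
     (\<forall>a\<in>Y. \<forall>b\<in>Y. \<exists>c\<in>Y. s {a} {b} = {c}) \<and>
     (\<forall>A\<subseteq>Y. \<forall>B\<subseteq>Y. \<forall>C\<subseteq>Y. \<forall>D\<subseteq>Y. \<forall>E\<subseteq>Y.
        s (s (s (s A B) C) D) E = setwise Q A B C D E)"

section \<open>The core\<close>

definition X :: "nat set" where
  "X = {1, 2, 3, 4}"

definition eps :: "nat \<Rightarrow> bit" where
  "eps x = (if x = 2 \<or> x = 3 then 1 else 0)"

definition eta :: "bit \<Rightarrow> nat" where
  "eta s = (if s = 0 then 4 else 3)"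

definition H5 :: "nat \<Rightarrow> nat \<Rightarrow> nat \<Rightarrow> nat \<Rightarrow> nat \<Rightarrow> nat" where
  "H5 x1 x2 x3 x4 x5 =
     (if x1 = 1 \<and> x2 = 1 \<and> x3 = 1 \<and> x4 = 1 \<and> x5 = 1 then 1
      else if x1 = 2 \<and> x2 = 2 \<and> x3 = 2 \<and> x4 = 2 \<and> x5 = 2 then 2
      else eta (eps x1 + eps x2 + eps x3 + eps x4 + eps x5))"

definition T5 :: "(nat set, nat set) tgs" where
  "T5 = powerset_complex X X H5"

definition of_blocks :: "'a set set \<Rightarrow> ('a \<times> 'a) set" where
  "of_blocks P = (\<Union>B\<in>P. B \<times> B)"

definition eq_lambda :: "(nat \<times> nat) set" where "eq_lambda = of_blocks {{1}, {2, 3}, {4}}"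
definition eq_mu :: "(nat \<times> nat) set" where "eq_mu = of_blocks {{1, 4}, {2}, {3}}"
definition eq_nu :: "(nat \<times> nat) set" where "eq_nu = of_blocks {{1}, {2}, {3, 4}}"
definition eq_alpha :: "(nat \<times> nat) set" where "eq_alpha = of_blocks {{1, 3, 4}, {2}}"
definition eq_pi :: "(nat \<times> nat) set" where "eq_pi = of_blocks {{1, 4}, {2, 3}}"
definition eq_beta :: "(nat \<times> nat) set" where "eq_beta = of_blocks {{1}, {2, 3, 4}}"
definition eq_nabla :: "(nat \<times> nat) set" where "eq_nabla = of_blocks {{1, 2, 3, 4}}"

end

theory Submission
  imports Defs
begin

text \<open>
  Because \<open>H\<^sub>5\<close> is symmetric, an equivalence pair is strong iff it is compatible with the unary
  translations \<open>u \<mapsto> H\<^sub>5(u, a, b, c, d)\<close>, and there are only four of these: two with all parameters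
  equal to \<open>1\<close> or to \<open>2\<close>, and one for each parity of the remaining parameter tuples. This makes the
  \<open>15 \<times> 15\<close> equivalence pairs a small finite check.

  A binary collapse of \<open>H\<^sub>5\<close> itself would have \<open>1 \<star> 1 = 1\<close> and \<open>2 \<star> 2 = 2\<close>, whence
  \<open>1 \<star> 2 = H\<^sub>5(1,1,1,1,2) = 3\<close> and \<open>1 \<star> 2 = H\<^sub>5(1,1,1,2,2) = 4\<close>.

  A join-preserving bijection of powersets permutes the singletons, so an isomorphism of quotient
  complexes preserves the size of the core and the existence of a left zero in it. These two
  invariants separate the five types, while the automorphism \<open>(1 2)(3 4)\<close> of \<open>H\<^sub>5\<close> carries \<open>\<alpha>\<close> to
  \<open>\<beta>\<close> and \<open>\<lambda>\<close> to \<open>\<mu>\<close>.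
\<close>

section \<open>Powerset complexes\<close>

text \<open>\<open>H5\<close> reads a five-letter word by its parity in Z_2, except that the words
  11111 and 22222 keep their letter. As 5 is odd, both exceptions have the parity that
  \<open>eta\<close> would produce, so nesting stays consistent and associativity survives. But 1
  and 2 become idempotents of different parity, and a binary product of 1 and 2 could not tell how
  many copies of 2 it has absorbed. Three identifications remove this conflict: 3 ~ 4 hides the
  parity, 2 ~ 3 and 1 ~ 4 each hide one exception. They generate \<nu>, \<lambda> and \<mu>, the
  atoms among the diagonal congruences, so every proper quotient makes at least one of them.

  An isomorphism of complexes may use unrelated maps on the carrier and the index sort. An invariant
  must therefore not compare a carrier element with an index element. This rules out idempotents of
  the core and suggests left zeros.\<close>

lemma add_order_Pow: "add_order (Pow Y) (\<union>) = \<lparr>carrier = Pow Y, eq = (=), le = (\<subseteq>)\<rparr>"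
  by (simp add: add_order_def subset_Un_eq fun_eq_iff)

text \<open>Suprema are defined by choice. Completeness of the powerset makes the chosen element a
  least upper bound, and uniqueness of least upper bounds identifies it with the union.\<close>

lemma sup_Pow:
  assumes "F \<subseteq> Pow Y"
  shows "\<Squnion>\<^bsub>add_order (Pow Y) (\<union>)\<^esub>F = \<Union>F"
proof -
  interpret L: complete_lattice "\<lparr>carrier = Pow Y, eq = (=), le = (\<subseteq>)\<rparr>"
    by (rule powerset_is_complete_lattice)
  have "least \<lparr>carrier = Pow Y, eq = (=), le = (\<subseteq>)\<rparr> (\<Union>F)
      (Upper \<lparr>carrier = Pow Y, eq = (=), le = (\<subseteq>)\<rparr> F)"
    using assms by (fastforce simp: least_def Upper_def)
  moreover have "least \<lparr>carrier = Pow Y, eq = (=), le = (\<subseteq>)\<rparr>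
      (\<Squnion>\<^bsub>\<lparr>carrier = Pow Y, eq = (=), le = (\<subseteq>)\<rparr>\<^esub>F)
      (Upper \<lparr>carrier = Pow Y, eq = (=), le = (\<subseteq>)\<rparr> F)"
    using assms by (intro L.sup_lub) simp
  ultimately show ?thesis
    unfolding add_order_Pow by (rule L.least_unique[symmetric])
qed

text \<open>The empty family has to be excluded: its infimum is \<open>Y\<close>, whereas its
  intersection is the whole type.\<close>

lemma inf_Pow:
  assumes "F \<subseteq> Pow Y" "F \<noteq> {}"
  shows "\<Sqinter>\<^bsub>add_order (Pow Y) (\<union>)\<^esub>F = \<Inter>F"
proof -
  interpret L: complete_lattice "\<lparr>carrier = Pow Y, eq = (=), le = (\<subseteq>)\<rparr>"
    by (rule powerset_is_complete_lattice)
  have "greatest \<lparr>carrier = Pow Y, eq = (=), le = (\<subseteq>)\<rparr> (\<Inter>F)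
      (Lower \<lparr>carrier = Pow Y, eq = (=), le = (\<subseteq>)\<rparr> F)"
    using assms by (fastforce simp: greatest_def Lower_def)
  moreover have "greatest \<lparr>carrier = Pow Y, eq = (=), le = (\<subseteq>)\<rparr>
      (\<Sqinter>\<^bsub>\<lparr>carrier = Pow Y, eq = (=), le = (\<subseteq>)\<rparr>\<^esub>F)
      (Lower \<lparr>carrier = Pow Y, eq = (=), le = (\<subseteq>)\<rparr> F)"
    using assms by (intro L.inf_glb) simp
  ultimately show ?thesis
    unfolding add_order_Pow by (rule L.greatest_unique[symmetric])
qed

lemma join_Pow: "A \<subseteq> Y \<Longrightarrow> B \<subseteq> Y \<Longrightarrow> A \<squnion>\<^bsub>add_order (Pow Y) (\<union>)\<^esub> B = A \<union> B"
  unfolding join_def by (subst sup_Pow) auto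

lemma meet_Pow: "A \<subseteq> Y \<Longrightarrow> B \<subseteq> Y \<Longrightarrow> A \<sqinter>\<^bsub>add_order (Pow Y) (\<union>)\<^esub> B = A \<inter> B"
  unfolding meet_def by (subst inf_Pow) auto

lemma bottom_Pow: "\<bottom>\<^bsub>add_order (Pow Y) (\<union>)\<^esub> = {}"
proof -
  have "\<bottom>\<^bsub>\<lparr>carrier = Pow Y, eq = (=), le = (\<subseteq>)\<rparr>\<^esub> = {}"
    unfolding bottom_def by (rule some_equality) (auto simp: least_def)
  then show ?thesis by (simp add: add_order_Pow)
qed

lemma top_Pow: "\<top>\<^bsub>add_order (Pow Y) (\<union>)\<^esub> = Y"
proof -
  have "\<top>\<^bsub>\<lparr>carrier = Pow Y, eq = (=), le = (\<subseteq>)\<rparr>\<^esub> = Y"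
    unfolding top_def by (rule some_equality) (auto simp: greatest_def)
  then show ?thesis by (simp add: add_order_Pow)
qed

lemma is_atom_Pow: "is_atom (add_order (Pow Y) (\<union>)) A \<longleftrightarrow> (\<exists>y\<in>Y. A = {y})"
proof
  assume "is_atom (add_order (Pow Y) (\<union>)) A"
  then have A: "A \<subseteq> Y" "A \<noteq> {}" "\<And>B. B \<subseteq> A \<Longrightarrow> B = {} \<or> B = A"
    unfolding is_atom_def bottom_Pow by (auto simp: add_order_Pow)
  then obtain y where "y \<in> A" by blast
  with A(3)[of "{y}"] A(1) show "\<exists>y\<in>Y. A = {y}" by auto
next
  assume "\<exists>y\<in>Y. A = {y}"
  then show "is_atom (add_order (Pow Y) (\<union>)) A"
    unfolding is_atom_def bottom_Pow by (auto simp: add_order_Pow)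
qed

lemma complete_atomic_boolean_Pow: "complete_atomic_boolean_lattice (add_order (Pow Y) (\<union>))"
proof -
  have 1: "complete_lattice (add_order (Pow Y) (\<union>))"
    unfolding add_order_Pow by (rule powerset_is_complete_lattice)
  have carr: "carrier (add_order (Pow Y) (\<union>)) = Pow Y" by (simp add: add_order_def)
  have 2: "\<exists>B\<in>Pow Y. A \<sqinter>\<^bsub>add_order (Pow Y) (\<union>)\<^esub> B = {} \<and> A \<squnion>\<^bsub>add_order (Pow Y) (\<union>)\<^esub> B = Y"
    if "A \<in> Pow Y" for A
    using that by (intro bexI[of _ "Y - A"]) (auto simp: join_Pow meet_Pow)
  have 3: "\<exists>a. is_atom (add_order (Pow Y) (\<union>)) a \<and> a \<sqsubseteq>\<^bsub>add_order (Pow Y) (\<union>)\<^esub> A"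
    if A: "A \<in> Pow Y" "A \<noteq> {}" for A
  proof -
    from A obtain y where "y \<in> A" by blast
    with A show ?thesis
      by (intro exI[of _ "{y}"]) (auto simp: is_atom_Pow, auto simp: add_order_Pow)
  qed
  have 4: "A \<sqinter>\<^bsub>add_order (Pow Y) (\<union>)\<^esub> (B \<squnion>\<^bsub>add_order (Pow Y) (\<union>)\<^esub> C)
      = (A \<sqinter>\<^bsub>add_order (Pow Y) (\<union>)\<^esub> B) \<squnion>\<^bsub>add_order (Pow Y) (\<union>)\<^esub> (A \<sqinter>\<^bsub>add_order (Pow Y) (\<union>)\<^esub> C)"
    if "A \<in> Pow Y" "B \<in> Pow Y" "C \<in> Pow Y" for A B C
  proof -
    have "B \<union> C \<subseteq> Y" "A \<inter> B \<subseteq> Y" "A \<inter> C \<subseteq> Y" using that by auto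
    with that show ?thesis by (auto simp: join_Pow meet_Pow)
  qed
  show ?thesis
    unfolding complete_atomic_boolean_lattice_def carr bottom_Pow top_Pow
    by (intro conjI ballI impI 1 2 3 4)
qed

lemma add_complete_Pow: "add_complete (Pow Y) (\<union>)"
  unfolding add_complete_def
proof (intro conjI ballI)
  show "complete_lattice (add_order (Pow Y) (\<union>))"
    unfolding add_order_Pow by (rule powerset_is_complete_lattice)
qed (simp add: join_Pow)

section \<open>Setwise products and the axioms of powerset complexes\<close>

text \<open>In this form, preservation of unions in each slot is distributivity of the Cartesian
  product.\<close>

lemma setwise_image:
  "setwise Q A B C D E = (\<lambda>(a, b, c, d, e). Q a b c d e) ` (A \<times> B \<times> C \<times> D \<times> E)"
  unfolding setwise_def by force

text \<open>In this form, nested products flatten to iterated unions of singletons, and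
  \<open>SUP_cong\<close> reduces an identity of setwise expressions to the identity of
  elements.\<close>

lemma setwise_UN:
  "setwise Q A B C D E = (\<Union>a\<in>A. \<Union>b\<in>B. \<Union>c\<in>C. \<Union>d\<in>D. \<Union>e\<in>E. {Q a b c d e})"
  unfolding setwise_def by blast
lemma setwise_Union:
  "setwise Q (\<Union>F) B C D E = (\<Union>A\<in>F. setwise Q A B C D E)"
  "setwise Q A (\<Union>G) C D E = (\<Union>B\<in>G. setwise Q A B C D E)"
  "setwise Q A B (\<Union>F) D E = (\<Union>C\<in>F. setwise Q A B C D E)"
  "setwise Q A B C (\<Union>G) E = (\<Union>D\<in>G. setwise Q A B C D E)"
  "setwise Q A B C D (\<Union>F) = (\<Union>E\<in>F. setwise Q A B C D E)"
proof -
  have "\<Union>F \<times> B \<times> C \<times> D \<times> E = (\<Union>A\<in>F. A \<times> B \<times> C \<times> D \<times> E)"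
    "A \<times> \<Union>G \<times> C \<times> D \<times> E = (\<Union>B\<in>G. A \<times> B \<times> C \<times> D \<times> E)"
    "A \<times> B \<times> \<Union>F \<times> D \<times> E = (\<Union>C\<in>F. A \<times> B \<times> C \<times> D \<times> E)"
    "A \<times> B \<times> C \<times> \<Union>G \<times> E = (\<Union>D\<in>G. A \<times> B \<times> C \<times> D \<times> E)"
    "A \<times> B \<times> C \<times> D \<times> \<Union>F = (\<Union>E\<in>F. A \<times> B \<times> C \<times> D \<times> E)"
    by blast+
  then show
    "setwise Q (\<Union>F) B C D E = (\<Union>A\<in>F. setwise Q A B C D E)"
    "setwise Q A (\<Union>G) C D E = (\<Union>B\<in>G. setwise Q A B C D E)"
    "setwise Q A B (\<Union>F) D E = (\<Union>C\<in>F. setwise Q A B C D E)"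
    "setwise Q A B C (\<Union>G) E = (\<Union>D\<in>G. setwise Q A B C D E)"
    "setwise Q A B C D (\<Union>F) = (\<Union>E\<in>F. setwise Q A B C D E)"
    by (simp_all only: setwise_image image_UN)
qed

lemma setwise_Un:
  "setwise Q (A \<union> A') B C D E = setwise Q A B C D E \<union> setwise Q A' B C D E"
  "setwise Q A B (C \<union> C') D E = setwise Q A B C D E \<union> setwise Q A B C' D E"
  "setwise Q A B C D (E \<union> E') = setwise Q A B C D E \<union> setwise Q A B C D E'"
  using setwise_Union(1)[of Q "{A, A'}"] setwise_Union(3)[of Q A B "{C, C'}"]
    setwise_Union(5)[of Q A B C D "{E, E'}"] by simp_all

lemma setwise_singleton [simp]: "setwise Q {a} {b} {c} {d} {e} = {Q a b c d e}"
  by (auto simp: setwise_def)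

lemma setwise_closed:
  assumes "\<And>x a y b z. \<lbrakk>x \<in> Y; a \<in> L; y \<in> Y; b \<in> L; z \<in> Y\<rbrakk> \<Longrightarrow> Q x a y b z \<in> Y"
    and "A \<subseteq> Y" "B \<subseteq> L" "C \<subseteq> Y" "D \<subseteq> L" "E \<subseteq> Y"
  shows "setwise Q A B C D E \<subseteq> Y"
  unfolding setwise_UN using assms(2-) by (auto intro!: assms(1))

lemma complete_atomic_boolean_powerset_complex: "complete_atomic_boolean (powerset_complex Y L Q)"
  by (simp add: complete_atomic_boolean_def powerset_complex_def complete_atomic_boolean_Pow)

lemma atom_total_powerset_complex:
  assumes "\<And>x a y b z. \<lbrakk>x \<in> Y; a \<in> L; y \<in> Y; b \<in> L; z \<in> Y\<rbrakk> \<Longrightarrow> Q x a y b z \<in> Y"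
  shows "atom_total (powerset_complex Y L Q)"
  using assms by (auto simp: atom_total_def powerset_complex_def is_atom_Pow)

lemma sup_preserving_Pow:
  assumes "\<And>A. A \<subseteq> Y \<Longrightarrow> h A \<subseteq> Z" and "\<And>F. F \<subseteq> Pow Y \<Longrightarrow> h (\<Union>F) = \<Union>(h ` F)"
  shows "sup_preserving (add_order (Pow Y) (\<union>)) (add_order (Pow Z) (\<union>)) h"
  unfolding sup_preserving_def
proof (intro allI impI)
  fix F assume "F \<subseteq> carrier (add_order (Pow Y) (\<union>))"
  then have F: "F \<subseteq> Pow Y" by (simp add: add_order_def)
  then have "h ` F \<subseteq> Pow Z" using assms(1) by blast
  with F assms(2) show "h (\<Squnion>\<^bsub>add_order (Pow Y) (\<union>)\<^esub>F) = \<Squnion>\<^bsub>add_order (Pow Z) (\<union>)\<^esub>(h ` F)"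
    by (simp add: sup_Pow)
qed

lemma completely_additive_powerset_complex:
  assumes Q: "\<And>x a y b z. \<lbrakk>x \<in> Y; a \<in> L; y \<in> Y; b \<in> L; z \<in> Y\<rbrakk> \<Longrightarrow> Q x a y b z \<in> Y"
  shows "completely_additive (powerset_complex Y L Q)"
proof -
  have "sup_preserving (add_order (Pow Y) (\<union>)) (add_order (Pow Y) (\<union>)) (\<lambda>t. setwise Q t a y b z)"
    "sup_preserving (add_order (Pow L) (\<union>)) (add_order (Pow Y) (\<union>)) (\<lambda>t. setwise Q x t y b z)"
    "sup_preserving (add_order (Pow Y) (\<union>)) (add_order (Pow Y) (\<union>)) (\<lambda>t. setwise Q x a t b z)"
    "sup_preserving (add_order (Pow L) (\<union>)) (add_order (Pow Y) (\<union>)) (\<lambda>t. setwise Q x a y t z)"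
    "sup_preserving (add_order (Pow Y) (\<union>)) (add_order (Pow Y) (\<union>)) (\<lambda>t. setwise Q x a y b t)"
    if S: "x \<subseteq> Y" "a \<subseteq> L" "y \<subseteq> Y" "b \<subseteq> L" "z \<subseteq> Y" for x a y b z
    by (intro sup_preserving_Pow setwise_Union setwise_closed[of Y L Q, OF Q] S; assumption)+
  then show ?thesis
    by (simp add: completely_additive_def powerset_complex_def add_complete_Pow)
qed

lemma ternary_gamma_semiring_powerset_complex:
  assumes Q: "\<And>x a y b z. \<lbrakk>x \<in> Y; a \<in> L; y \<in> Y; b \<in> L; z \<in> Y\<rbrakk> \<Longrightarrow> Q x a y b z \<in> Y"
    and assoc1: "\<And>x a y b z c u d v.
      \<lbrakk>x \<in> Y; a \<in> L; y \<in> Y; b \<in> L; z \<in> Y; c \<in> L; u \<in> Y; d \<in> L; v \<in> Y\<rbrakk>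
      \<Longrightarrow> Q (Q x a y b z) c u d v = Q x a (Q y b z c u) d v"
    and assoc2: "\<And>x a y b z c u d v.
      \<lbrakk>x \<in> Y; a \<in> L; y \<in> Y; b \<in> L; z \<in> Y; c \<in> L; u \<in> Y; d \<in> L; v \<in> Y\<rbrakk>
      \<Longrightarrow> Q x a (Q y b z c u) d v = Q x a y b (Q z c u d v)"
  shows "ternary_gamma_semiring (powerset_complex Y L Q)"
proof
  fix x a y b z c u d v
  assume sub: "x \<in> scarrier (powerset_complex Y L Q)" "a \<in> gcarrier (powerset_complex Y L Q)"
    "y \<in> scarrier (powerset_complex Y L Q)" "b \<in> gcarrier (powerset_complex Y L Q)"
    "z \<in> scarrier (powerset_complex Y L Q)"
  then show "tprod (powerset_complex Y L Q) x a y b z \<in> scarrier (powerset_complex Y L Q)"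
    using setwise_closed[of Y L Q, OF Q] by (simp add: powerset_complex_def)
  assume sub2: "c \<in> gcarrier (powerset_complex Y L Q)" "u \<in> scarrier (powerset_complex Y L Q)"
    "d \<in> gcarrier (powerset_complex Y L Q)" "v \<in> scarrier (powerset_complex Y L Q)"
  have S: "x \<subseteq> Y" "a \<subseteq> L" "y \<subseteq> Y" "b \<subseteq> L" "z \<subseteq> Y" "c \<subseteq> L" "u \<subseteq> Y" "d \<subseteq> L" "v \<subseteq> Y"
    using sub sub2 by (simp_all add: powerset_complex_def)
  show "tprod (powerset_complex Y L Q) (tprod (powerset_complex Y L Q) x a y b z) c u d v =
      tprod (powerset_complex Y L Q) x a (tprod (powerset_complex Y L Q) y b z c u) d v"
    unfolding powerset_complex_def tgs.simps setwise_UN UN_UN_flatten UN_insert UN_empty Un_empty_right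
    by (intro SUP_cong refl arg_cong[where f = "\<lambda>x. {x}"] assoc1) (use S in auto)
  show "tprod (powerset_complex Y L Q) x a (tprod (powerset_complex Y L Q) y b z c u) d v =
      tprod (powerset_complex Y L Q) x a y b (tprod (powerset_complex Y L Q) z c u d v)"
    unfolding powerset_complex_def tgs.simps setwise_UN UN_UN_flatten UN_insert UN_empty Un_empty_right
    by (intro SUP_cong refl arg_cong[where f = "\<lambda>x. {x}"] assoc2) (use S in auto)
qed (auto simp: powerset_complex_def comm_semigroup_on_def setwise_Un)

section \<open>Isomorphisms\<close>

lemma tgs_iso_trans:
  assumes "tgs_iso f g T U" "tgs_iso f' g' U V"
  shows "tgs_iso (f' \<circ> f) (g' \<circ> g) T V"
proof -
  have "\<And>x. x \<in> scarrier T \<Longrightarrow> f x \<in> scarrier U" "\<And>a. a \<in> gcarrier T \<Longrightarrow> g a \<in> gcarrier U"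
    using assms(1) by (auto simp: tgs_iso_def bij_betw_apply)
  with assms show ?thesis
    unfolding tgs_iso_def by (auto intro: bij_betw_trans)
qed

text \<open>The record alone does not guarantee closure. It is assumed here because
  \<open>inv_into\<close> undoes \<open>f\<close> and \<open>g\<close> only on results that lie in
  the carriers of \<open>T\<close>.\<close>

lemma tgs_iso_sym:
  assumes iso: "tgs_iso f g T U"
    and closed: "\<And>x y. x \<in> scarrier T \<Longrightarrow> y \<in> scarrier T \<Longrightarrow> sadd T x y \<in> scarrier T"
      "\<And>a b. a \<in> gcarrier T \<Longrightarrow> b \<in> gcarrier T \<Longrightarrow> gadd T a b \<in> gcarrier T"
      "\<And>x a y b z. \<lbrakk>x \<in> scarrier T; a \<in> gcarrier T; y \<in> scarrier T; b \<in> gcarrier T; z \<in> scarrier T\<rbrakk>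
        \<Longrightarrow> tprod T x a y b z \<in> scarrier T"
  shows "tgs_iso (inv_into (scarrier T) f) (inv_into (gcarrier T) g) U T"
proof -
  let ?f = "inv_into (scarrier T) f" and ?g = "inv_into (gcarrier T) g"
  have f: "bij_betw f (scarrier T) (scarrier U)" and g: "bij_betw g (gcarrier T) (gcarrier U)"
    using iso by (auto simp: tgs_iso_def)
  have fin: "?f u \<in> scarrier T" "f (?f u) = u" if "u \<in> scarrier U" for u
    using that f by (auto simp: bij_betw_def inv_into_into f_inv_into_f)
  have gin: "?g u \<in> gcarrier T" "g (?g u) = u" if "u \<in> gcarrier U" for u
    using that g by (auto simp: bij_betw_def inv_into_into f_inv_into_f)
  have fi: "?f (f x) = x" if "x \<in> scarrier T" for x
    using that f by (simp add: bij_betw_inv_into_left)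
  have gi: "?g (g x) = x" if "x \<in> gcarrier T" for x
    using that g by (simp add: bij_betw_inv_into_left)
  have "?f (sadd U x y) = sadd T (?f x) (?f y)" if "x \<in> scarrier U" "y \<in> scarrier U" for x y
    using that iso fi[of "sadd T (?f x) (?f y)"] by (simp add: tgs_iso_def fin closed)
  moreover have "?g (gadd U x y) = gadd T (?g x) (?g y)" if "x \<in> gcarrier U" "y \<in> gcarrier U" for x y
    using that iso gi[of "gadd T (?g x) (?g y)"] by (simp add: tgs_iso_def gin closed)
  moreover have "?f (tprod U x a y b z) = tprod T (?f x) (?g a) (?f y) (?g b) (?f z)"
    if "x \<in> scarrier U" "a \<in> gcarrier U" "y \<in> scarrier U" "b \<in> gcarrier U" "z \<in> scarrier U"
    for x a y b z
    using that iso fi[of "tprod T (?f x) (?g a) (?f y) (?g b) (?f z)"]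
    by (simp add: tgs_iso_def fin gin closed)
  ultimately show ?thesis
    using f g by (simp add: tgs_iso_def bij_betw_inv_into)
qed

lemma tgs_iso_powerset_complex_sym:
  assumes "tgs_iso f g (powerset_complex Y L Q) U"
    and "\<And>x a y b z. \<lbrakk>x \<in> Y; a \<in> L; y \<in> Y; b \<in> L; z \<in> Y\<rbrakk> \<Longrightarrow> Q x a y b z \<in> Y"
  shows "tgs_iso (inv_into (Pow Y) f) (inv_into (Pow L) g) U (powerset_complex Y L Q)"
  using tgs_iso_sym[OF assms(1)] setwise_closed[of Y L Q, OF assms(2)]
  by (simp add: powerset_complex_def)

section \<open>Join isomorphisms of powersets and their invariants\<close>

lemma join_bij_subset_iff:
  assumes f: "bij_betw f (Pow Y) (Pow Z)"
    and join: "\<And>A B. A \<subseteq> Y \<Longrightarrow> B \<subseteq> Y \<Longrightarrow> f (A \<union> B) = f A \<union> f B"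
    and "A \<subseteq> Y" "B \<subseteq> Y"
  shows "f A \<subseteq> f B \<longleftrightarrow> A \<subseteq> B"
proof -
  have "f A \<subseteq> f B \<longleftrightarrow> f (A \<union> B) = f B"
    using assms by (simp add: subset_Un_eq)
  also have "\<dots> \<longleftrightarrow> A \<union> B = B"
    using assms by (intro inj_on_eq_iff[OF bij_betw_imp_inj_on[OF f]]) auto
  finally show ?thesis by (simp add: subset_Un_eq)
qed

text \<open>Singletons are the minimal non-empty sets, and \<open>f\<close> preserves and reflects
  inclusion. The preimage of a point of \<open>f {y}\<close> is non-empty and lies below
  \<open>{y}\<close>, so it is \<open>{y}\<close>.\<close>

lemma join_bij_singleton:
  assumes f: "bij_betw f (Pow Y) (Pow Z)"
    and join: "\<And>A B. A \<subseteq> Y \<Longrightarrow> B \<subseteq> Y \<Longrightarrow> f (A \<union> B) = f A \<union> f B"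
    and y: "y \<in> Y"
  shows "\<exists>z\<in>Z. f {y} = {z}"
proof -
  note sub = join_bij_subset_iff[OF f join]
  have surj: "\<exists>A\<subseteq>Y. f A = C" if "C \<subseteq> Z" for C
  proof -
    have "C \<in> f ` Pow Y" using that bij_betw_imp_surj_on[OF f] by simp
    then show ?thesis by auto
  qed
  have "f {y} \<in> Pow Z" using y by (intro bij_betw_apply[OF f]) simp
  then have yZ: "f {y} \<subseteq> Z" by simp
  obtain N where N: "N \<subseteq> Y" "f N = {}" using surj[of "{}"] by auto
  then have "N \<subseteq> {}" using sub[of N "{}"] by auto
  then have f0: "f {} = {}" using N by simp
  have "\<not> f {y} \<subseteq> f {}" using y sub[of "{y}" "{}"] by simp
  then obtain z where z: "z \<in> f {y}" by auto
  with yZ have zZ: "z \<in> Z" by auto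
  then obtain A where A: "A \<subseteq> Y" "f A = {z}" using surj[of "{z}"] by auto
  have "A \<subseteq> {y}" using sub[of A "{y}"] A y z by auto
  moreover have "A \<noteq> {}" using A f0 by auto
  ultimately have "A = {y}" by auto
  with A zZ show ?thesis by auto
qed

text \<open>The inverse bijection preserves joins too, so the previous lemma applies to it.\<close>

lemma join_bij_singleton_preimage:
  assumes f: "bij_betw f (Pow Y) (Pow Z)"
    and join: "\<And>A B. A \<subseteq> Y \<Longrightarrow> B \<subseteq> Y \<Longrightarrow> f (A \<union> B) = f A \<union> f B"
    and z: "z \<in> Z"
  shows "\<exists>y\<in>Y. f {y} = {z}"
proof -
  let ?g = "inv_into (Pow Y) f"
  have g: "bij_betw ?g (Pow Z) (Pow Y)" using f by (rule bij_betw_inv_into)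
  have gin: "?g C \<subseteq> Y" "f (?g C) = C" if "C \<subseteq> Z" for C
    using that bij_betw_apply[OF g, of C] bij_betw_inv_into_right[OF f, of C] by auto
  have "?g (A \<union> B) = ?g A \<union> ?g B" if "A \<subseteq> Z" "B \<subseteq> Z" for A B
  proof -
    have "f (?g A \<union> ?g B) = A \<union> B" using that gin join by simp
    moreover have "?g A \<union> ?g B \<in> Pow Y" using that gin by simp
    ultimately show ?thesis using bij_betw_inv_into_left[OF f] by metis
  qed
  from join_bij_singleton[OF g this z] obtain y where "y \<in> Y" "?g {z} = {y}" by auto
  with gin(2)[of "{z}"] z show ?thesis by auto
qed

lemma card_eq_if_bij_Pow:
  assumes "bij_betw f (Pow Y) (Pow Z)" "finite Y"
  shows "card Y = card Z"
proof -
  have "finite Z" using bij_betw_finite[OF assms(1)] assms(2) by simp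
  moreover have "card (Pow Y) = card (Pow Z)" using assms(1) by (rule bij_betw_same_card)
  ultimately show ?thesis using assms(2) by (simp add: card_Pow)
qed

text \<open>The law equates two carrier elements and quantifies over all index elements, so it
  survives isomorphisms whose carrier and index maps differ.\<close>

definition has_left_zero :: "'a set \<Rightarrow> 'b set \<Rightarrow> ('a \<Rightarrow> 'b \<Rightarrow> 'a \<Rightarrow> 'b \<Rightarrow> 'a \<Rightarrow> 'a) \<Rightarrow> bool" where
  "has_left_zero Y L Q \<longleftrightarrow> (\<exists>x\<in>Y. \<forall>a\<in>L. \<forall>y\<in>Y. \<forall>b\<in>L. \<forall>z\<in>Y. Q x a y b z = x)"

text \<open>Both maps permute atoms in the sense of \<open>join_bij_singleton\<close> and its
  converse, so the law is read off products of singletons.\<close>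

lemma has_left_zero_transfer:
  assumes iso: "tgs_iso f g (powerset_complex Y L Q) (powerset_complex Z M P)"
    and zero: "has_left_zero Y L Q"
  shows "has_left_zero Z M P"
proof -
  have f: "bij_betw f (Pow Y) (Pow Z)" "\<And>A B. A \<subseteq> Y \<Longrightarrow> B \<subseteq> Y \<Longrightarrow> f (A \<union> B) = f A \<union> f B"
    and g: "bij_betw g (Pow L) (Pow M)" "\<And>A B. A \<subseteq> L \<Longrightarrow> B \<subseteq> L \<Longrightarrow> g (A \<union> B) = g A \<union> g B"
    and prod: "\<And>x a y b z. \<lbrakk>x \<subseteq> Y; a \<subseteq> L; y \<subseteq> Y; b \<subseteq> L; z \<subseteq> Y\<rbrakk>
      \<Longrightarrow> f (setwise Q x a y b z) = setwise P (f x) (g a) (f y) (g b) (f z)"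
    using iso by (auto simp: tgs_iso_def powerset_complex_def)
  obtain x where x: "x \<in> Y" "\<And>a y b z. \<lbrakk>a \<in> L; y \<in> Y; b \<in> L; z \<in> Y\<rbrakk> \<Longrightarrow> Q x a y b z = x"
    using zero by (auto simp: has_left_zero_def)
  obtain x' where x': "x' \<in> Z" "f {x} = {x'}" using join_bij_singleton[OF f x(1)] by auto
  have "P x' a' y' b' z' = x'" if in': "a' \<in> M" "y' \<in> Z" "b' \<in> M" "z' \<in> Z" for a' y' b' z'
  proof -
    obtain a y b z where "a \<in> L" "g {a} = {a'}" "y \<in> Y" "f {y} = {y'}"
      "b \<in> L" "g {b} = {b'}" "z \<in> Y" "f {z} = {z'}"
      using join_bij_singleton_preimage[OF g] join_bij_singleton_preimage[OF f] in' by metis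
    with prod[of "{x}" "{a}" "{y}" "{b}" "{z}"] x x' show ?thesis by simp
  qed
  with x'(1) show ?thesis unfolding has_left_zero_def by blast
qed

section \<open>Saturated congruences and their quotients\<close>

lemma quotient_image: "A // \<theta> = (\<lambda>a. \<theta> `` {a}) ` A"
  by (auto simp: quotient_def)

lemma quotient_eq_iff:
  assumes "equiv Y \<theta>" "A \<subseteq> Y" "B \<subseteq> Y"
  shows "A // \<theta> = B // \<theta> \<longleftrightarrow> (\<forall>a\<in>A. \<exists>b\<in>B. (a, b) \<in> \<theta>) \<and> (\<forall>b\<in>B. \<exists>a\<in>A. (a, b) \<in> \<theta>)"
proof -
  have "\<theta> `` {a} = \<theta> `` {b} \<longleftrightarrow> (a, b) \<in> \<theta>" "\<theta> `` {b} = \<theta> `` {a} \<longleftrightarrow> (a, b) \<in> \<theta>"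
    if "a \<in> A" "b \<in> B" for a b
    using that assms eq_equiv_class_iff[of Y \<theta> a b] by auto
  then show ?thesis
    by (simp add: quotient_image set_eq_subset[of "_ ` A"] image_subset_iff image_iff cong: bex_cong ball_cong)
qed

lemma saturated_eq:
  assumes "equiv Y \<theta>"
  shows "saturated Y \<theta> = {(A, B). A \<subseteq> Y \<and> B \<subseteq> Y \<and>
    (\<forall>a\<in>A. \<exists>b\<in>B. (a, b) \<in> \<theta>) \<and> (\<forall>b\<in>B. \<exists>a\<in>A. (a, b) \<in> \<theta>)}"
  unfolding saturated_def by (simp add: quotient_eq_iff[OF assms] cong: conj_cong)

text \<open>Pairs of singletons recover the equivalence from its lift. Counting and ordering the
  lifted congruences thus becomes counting and ordering equivalences on atoms.\<close>

lemma saturated_subset_iff: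
  assumes "equiv Y \<theta>" "equiv Y \<phi>"
  shows "saturated Y \<theta> \<subseteq> saturated Y \<phi> \<longleftrightarrow> \<theta> \<subseteq> \<phi>"
proof
  assume sub: "saturated Y \<theta> \<subseteq> saturated Y \<phi>"
  show "\<theta> \<subseteq> \<phi>"
  proof
    fix p assume p: "p \<in> \<theta>"
    obtain x y where xy: "p = (x, y)" by fastforce
    with p have "x \<in> Y" "y \<in> Y" using assms(1) by (auto simp: equiv_def refl_on_def)
    with p xy have "({x}, {y}) \<in> saturated Y \<theta>" by (simp add: saturated_eq[OF assms(1)])
    with sub have "({x}, {y}) \<in> saturated Y \<phi>" by blast
    with xy show "p \<in> \<phi>" by (simp add: saturated_eq[OF assms(2)])
  qed
next
  assume "\<theta> \<subseteq> \<phi>"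
  then show "saturated Y \<theta> \<subseteq> saturated Y \<phi>"
    by (auto simp: saturated_eq[OF assms(1)] saturated_eq[OF assms(2)]) blast+
qed

lemma saturated_eq_iff:
  assumes "equiv Y \<theta>" "equiv Y \<phi>"
  shows "saturated Y \<theta> = saturated Y \<phi> \<longleftrightarrow> \<theta> = \<phi>"
  using saturated_subset_iff[OF assms] saturated_subset_iff[OF assms(2,1)] by blast

lemma equiv_saturated: "equiv (Pow Y) (saturated Y \<theta>)"
  by (auto simp: equiv_def refl_on_def sym_def trans_def saturated_def)

lemma strong_frame_congruenceD:
  assumes "strong_frame_congruence Y L Q \<theta> \<phi>"
    and "(x, x') \<in> \<theta>" "(a, a') \<in> \<phi>" "(y, y') \<in> \<theta>" "(b, b') \<in> \<phi>" "(z, z') \<in> \<theta>"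
  shows "(Q x a y b z, Q x' a' y' b' z') \<in> \<theta>"
proof -
  have "\<forall>(x, x')\<in>\<theta>. \<forall>(a, a')\<in>\<phi>. \<forall>(y, y')\<in>\<theta>. \<forall>(b, b')\<in>\<phi>. \<forall>(z, z')\<in>\<theta>.
      (Q x a y b z, Q x' a' y' b' z') \<in> \<theta>"
    using assms(1) by (simp add: strong_frame_congruence_def)
  from bspec[OF this assms(2), unfolded prod.case, THEN bspec, OF assms(3), unfolded prod.case,
      THEN bspec, OF assms(4), unfolded prod.case, THEN bspec, OF assms(5), unfolded prod.case,
      THEN bspec, OF assms(6)]
  show ?thesis by simp
qed

text \<open>One half of the back-and-forth condition in \<open>saturated_eq\<close>. The other half
  is the same statement with primed and unprimed sets exchanged, up to symmetry of the
  equivalences.\<close>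

lemma setwise_related:
  assumes strong: "strong_frame_congruence Y L Q \<theta> \<phi>"
    and "\<forall>a\<in>A. \<exists>a'\<in>A'. (a, a') \<in> \<theta>" "\<forall>b\<in>B. \<exists>b'\<in>B'. (b, b') \<in> \<phi>"
      "\<forall>c\<in>C. \<exists>c'\<in>C'. (c, c') \<in> \<theta>" "\<forall>d\<in>D. \<exists>d'\<in>D'. (d, d') \<in> \<phi>"
      "\<forall>e\<in>E. \<exists>e'\<in>E'. (e, e') \<in> \<theta>"
  shows "\<forall>u\<in>setwise Q A B C D E. \<exists>v\<in>setwise Q A' B' C' D' E'. (u, v) \<in> \<theta>"
proof
  fix u assume "u \<in> setwise Q A B C D E"
  then obtain a b c d e where u: "u = Q a b c d e" "a \<in> A" "b \<in> B" "c \<in> C" "d \<in> D" "e \<in> E"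
    by (auto simp: setwise_def)
  then obtain a' b' c' d' e' where v: "a' \<in> A'" "b' \<in> B'" "c' \<in> C'" "d' \<in> D'" "e' \<in> E'"
      and rel: "(a, a') \<in> \<theta>" "(b, b') \<in> \<phi>" "(c, c') \<in> \<theta>" "(d, d') \<in> \<phi>" "(e, e') \<in> \<theta>"
    using assms(2-) by metis
  have "(Q a b c d e, Q a' b' c' d' e') \<in> \<theta>"
    using strong rel by (rule strong_frame_congruenceD)
  moreover have "Q a' b' c' d' e' \<in> setwise Q A' B' C' D' E'"
    using v unfolding setwise_def by blast
  ultimately show "\<exists>v\<in>setwise Q A' B' C' D' E'. (u, v) \<in> \<theta>" using u(1) by blast
qed

lemma congruence_pair_saturated:
  assumes closed: "\<And>x a y b z. \<lbrakk>x \<in> Y; a \<in> L; y \<in> Y; b \<in> L; z \<in> Y\<rbrakk> \<Longrightarrow> Q x a y b z \<in> Y"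
    and strong: "strong_frame_congruence Y L Q \<theta> \<phi>"
  shows "congruence_pair (powerset_complex Y L Q) (saturated Y \<theta>) (saturated L \<phi>)"
proof -
  have eqs: "equiv Y \<theta>" "equiv L \<phi>" using strong by (simp_all add: strong_frame_congruence_def)
  have sym: "(\<forall>b\<in>B. \<exists>a\<in>A. (a, b) \<in> r) \<longleftrightarrow> (\<forall>b\<in>B. \<exists>a\<in>A. (b, a) \<in> r)"
    if "equiv Z r" for A B Z and r :: "('z \<times> 'z) set"
    using that unfolding equiv_def by (meson symD)
  have un: "(A \<union> B, A' \<union> B') \<in> saturated Z r"
    if "(A, A') \<in> saturated Z r" "(B, B') \<in> saturated Z r" for A B A' B' Z and r :: "('z \<times> 'z) set"
    using that by (auto simp: saturated_def quotient_image image_Un)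
  have prod: "(setwise Q A B C D E, setwise Q A' B' C' D' E') \<in> saturated Y \<theta>"
    if "(A, A') \<in> saturated Y \<theta>" "(B, B') \<in> saturated L \<phi>" "(C, C') \<in> saturated Y \<theta>"
      "(D, D') \<in> saturated L \<phi>" "(E, E') \<in> saturated Y \<theta>" for A A' B B' C C' D D' E E'
    using that setwise_related[OF strong, of A A' B B' C C' D D' E E']
      setwise_related[OF strong, of A' A B' B C' C D' D E' E]
      setwise_closed[of Y L Q A B C D E, OF closed] setwise_closed[of Y L Q A' B' C' D' E', OF closed]
    unfolding saturated_eq[OF eqs(1)] saturated_eq[OF eqs(2)] by (simp add: sym[OF eqs(1)] sym[OF eqs(2)])
  show ?thesis
    unfolding congruence_pair_def powerset_complex_def
    by (auto intro: un prod simp: equiv_saturated)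
qed

text \<open>From here on only conditions on atoms have to be checked.\<close>

lemma induces_strong_iff:
  assumes "\<And>x a y b z. \<lbrakk>x \<in> Y; a \<in> L; y \<in> Y; b \<in> L; z \<in> Y\<rbrakk> \<Longrightarrow> Q x a y b z \<in> Y"
  shows "induces_strong Y L Q \<theta> \<phi> \<longleftrightarrow> strong_frame_congruence Y L Q \<theta> \<phi>"
  using congruence_pair_saturated[OF assms] by (auto simp: induces_strong_def)

text \<open>Serves the quotient operations, which unite the classes obtained from all
  representatives.\<close>

lemma UN_eq_const: "\<lbrakk>S \<noteq> {}; \<And>x. x \<in> S \<Longrightarrow> f x = K\<rbrakk> \<Longrightarrow> (\<Union>x\<in>S. f x) = K"
  by auto

section \<open>The quotient by a diagonal congruence as a powerset complex\<close>

locale diagonal_congruence =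
  fixes Y :: "'a set" and Q \<theta>
  assumes closed: "\<And>a b c d e. \<lbrakk>a \<in> Y; b \<in> Y; c \<in> Y; d \<in> Y; e \<in> Y\<rbrakk> \<Longrightarrow> Q a b c d e \<in> Y"
    and strong: "strong_frame_congruence Y Y Q \<theta> \<theta>"
begin

lemma equiv: "equiv Y \<theta>"
  using strong by (simp add: strong_frame_congruence_def)

lemma related:
  "\<lbrakk>(a, a') \<in> \<theta>; (b, b') \<in> \<theta>; (c, c') \<in> \<theta>; (d, d') \<in> \<theta>; (e, e') \<in> \<theta>\<rbrakk>
    \<Longrightarrow> (Q a b c d e, Q a' b' c' d' e') \<in> \<theta>"
  using strong by (rule strong_frame_congruenceD)

lemma class_eq: "(a, b) \<in> \<theta> \<Longrightarrow> \<theta> `` {a} = \<theta> `` {b}"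
  using equiv by (rule equiv_class_eq)

lemma core_quotient_class:
  assumes "a \<in> Y" "b \<in> Y" "c \<in> Y" "d \<in> Y" "e \<in> Y"
  shows "core_quotient Q \<theta> (\<theta> `` {a}) (\<theta> `` {b}) (\<theta> `` {c}) (\<theta> `` {d}) (\<theta> `` {e}) = \<theta> `` {Q a b c d e}"
  unfolding core_quotient_def
  by (intro UN_eq_const class_eq[symmetric] related)
    (use assms equiv_class_self[OF equiv] in blast)+

lemma core_quotient_closed:
  assumes "A \<in> Y // \<theta>" "B \<in> Y // \<theta>" "C \<in> Y // \<theta>" "D \<in> Y // \<theta>" "E \<in> Y // \<theta>"
  shows "core_quotient Q \<theta> A B C D E \<in> Y // \<theta>"
  using assms by (auto simp: quotient_image core_quotient_class closed)

lemma setwise_quotient: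
  assumes "A \<subseteq> Y" "B \<subseteq> Y" "C \<subseteq> Y" "D \<subseteq> Y" "E \<subseteq> Y"
  shows "setwise Q A B C D E // \<theta> =
    setwise (core_quotient Q \<theta>) (A // \<theta>) (B // \<theta>) (C // \<theta>) (D // \<theta>) (E // \<theta>)"
proof -
  have "setwise (core_quotient Q \<theta>) (A // \<theta>) (B // \<theta>) (C // \<theta>) (D // \<theta>) (E // \<theta>) =
    (\<Union>a\<in>A. \<Union>b\<in>B. \<Union>c\<in>C. \<Union>d\<in>D. \<Union>e\<in>E. {\<theta> `` {Q a b c d e}})"
    unfolding setwise_UN quotient_image image_image
    by (intro SUP_cong refl arg_cong[where f = "\<lambda>x. {x}"] core_quotient_class) (use assms in auto)
  then show ?thesis by (simp add: setwise_UN quotient_image image_UN)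
qed

text \<open>Parametrises the classes of the lifted congruence by the subsets of the quotient core;
  it turns out to be the isomorphism of complexes.\<close>

definition fibre :: "'a set set \<Rightarrow> 'a set set" where
  "fibre P = {A. A \<subseteq> Y \<and> A // \<theta> = P}"

lemma saturated_class: "A \<subseteq> Y \<Longrightarrow> saturated Y \<theta> `` {A} = fibre (A // \<theta>)"
  by (auto simp: saturated_def fibre_def)

lemma fibre_nonempty:
  assumes "P \<subseteq> Y // \<theta>"
  shows "fibre P \<noteq> {}"
proof -
  obtain A where "A \<subseteq> Y" "(\<lambda>a. \<theta> `` {a}) ` A = P"
    using assms by (auto simp: quotient_image subset_image_iff)
  then show ?thesis by (auto simp: fibre_def quotient_image)
qed

lemma bij_betw_fibre: "bij_betw fibre (Pow (Y // \<theta>)) (Pow Y // saturated Y \<theta>)"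
  unfolding bij_betw_def
proof
  show "inj_on fibre (Pow (Y // \<theta>))"
  proof (rule inj_onI)
    fix P P' assume "P \<in> Pow (Y // \<theta>)" "fibre P = fibre P'"
    then show "P = P'" using fibre_nonempty[of P] by (auto simp: fibre_def)
  qed
  have "Pow Y // saturated Y \<theta> = (\<lambda>A. fibre (A // \<theta>)) ` Pow Y"
    unfolding quotient_image[of "Pow Y"] using saturated_class by (intro image_cong refl) auto
  also have "\<dots> = fibre ` ((`) (\<lambda>a. \<theta> `` {a}) ` Pow Y)"
    by (simp only: image_image quotient_image)
  also have "\<dots> = fibre ` Pow (Y // \<theta>)"
    by (simp only: image_Pow_surj[OF quotient_image[symmetric]])
  finally show "fibre ` Pow (Y // \<theta>) = Pow Y // saturated Y \<theta>" by simp
qed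

lemma tgs_iso_fibre:
  "tgs_iso fibre fibre (powerset_complex (Y // \<theta>) (Y // \<theta>) (core_quotient Q \<theta>)) (diagonal_quotient Y Q \<theta>)"
proof -
  have un: "(\<Union>A\<in>fibre P. \<Union>B\<in>fibre P'. saturated Y \<theta> `` {A \<union> B}) = fibre (P \<union> P')"
    if "P \<subseteq> Y // \<theta>" "P' \<subseteq> Y // \<theta>" for P P'
  proof (intro UN_eq_const fibre_nonempty that)
    fix A B assume "A \<in> fibre P" "B \<in> fibre P'"
    then show "saturated Y \<theta> `` {A \<union> B} = fibre (P \<union> P')"
      by (subst saturated_class) (auto simp: fibre_def quotient_image image_Un)
  qed
  have prod: "(\<Union>a\<in>fibre A. \<Union>b\<in>fibre B. \<Union>c\<in>fibre C. \<Union>d\<in>fibre D. \<Union>e\<in>fibre E.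
      saturated Y \<theta> `` {setwise Q a b c d e}) = fibre (setwise (core_quotient Q \<theta>) A B C D E)"
    if "A \<subseteq> Y // \<theta>" "B \<subseteq> Y // \<theta>" "C \<subseteq> Y // \<theta>" "D \<subseteq> Y // \<theta>" "E \<subseteq> Y // \<theta>" for A B C D E
  proof (intro UN_eq_const fibre_nonempty that)
    fix a b c d e
    assume "a \<in> fibre A" "b \<in> fibre B" "c \<in> fibre C" "d \<in> fibre D" "e \<in> fibre E"
    then show "saturated Y \<theta> `` {setwise Q a b c d e} = fibre (setwise (core_quotient Q \<theta>) A B C D E)"
      using setwise_closed[of Y Y Q a b c d e, OF closed]
      by (subst saturated_class) (auto simp: fibre_def setwise_quotient)
  qed
  show ?thesis
    unfolding tgs_iso_def diagonal_quotient_def tgs_quotient_def powerset_complex_def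
    by (simp add: bij_betw_fibre un prod)
qed

lemma tgs_iso_diagonal_quotient:
  "\<exists>f. tgs_iso f f (diagonal_quotient Y Q \<theta>)
    (powerset_complex (Y // \<theta>) (Y // \<theta>) (core_quotient Q \<theta>))"
  using tgs_iso_powerset_complex_sym[OF tgs_iso_fibre core_quotient_closed] by blast

end

section \<open>Isomorphisms of cores and of quotient complexes\<close>

lemma tgs_iso_core:
  assumes h: "bij_betw h Y Z"
    and hom: "\<And>a b c d e. \<lbrakk>a \<in> Y; b \<in> Y; c \<in> Y; d \<in> Y; e \<in> Y\<rbrakk>
      \<Longrightarrow> h (Q a b c d e) = P (h a) (h b) (h c) (h d) (h e)"
  shows "tgs_iso ((`) h) ((`) h) (powerset_complex Y Y Q) (powerset_complex Z Z P)"
proof -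
  have "h ` setwise Q A B C D E = setwise P (h ` A) (h ` B) (h ` C) (h ` D) (h ` E)"
    if "A \<subseteq> Y" "B \<subseteq> Y" "C \<subseteq> Y" "D \<subseteq> Y" "E \<subseteq> Y" for A B C D E
    unfolding setwise_UN image_image image_UN image_insert image_empty
    by (intro SUP_cong refl arg_cong[where f = "\<lambda>x. {x}"] hom) (use that in auto)
  then show ?thesis
    using bij_betw_Pow[OF h] by (simp add: tgs_iso_def powerset_complex_def image_Un)
qed

lemma tgs_isomorphic_if_core_isomorphic:
  assumes "diagonal_congruence Y Q \<theta>" "diagonal_congruence Z P \<phi>"
    and "core_isomorphic (Y // \<theta>) (core_quotient Q \<theta>) (Z // \<phi>) (core_quotient P \<phi>)"
  shows "tgs_isomorphic (diagonal_quotient Y Q \<theta>) (diagonal_quotient Z P \<phi>)"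
proof -
  obtain h where h: "bij_betw h (Y // \<theta>) (Z // \<phi>)"
      "\<forall>a\<in>Y // \<theta>. \<forall>b\<in>Y // \<theta>. \<forall>c\<in>Y // \<theta>. \<forall>d\<in>Y // \<theta>. \<forall>e\<in>Y // \<theta>.
        h (core_quotient Q \<theta> a b c d e) = core_quotient P \<phi> (h a) (h b) (h c) (h d) (h e)"
    using assms(3) unfolding core_isomorphic_def by blast
  have "tgs_iso ((`) h) ((`) h) (powerset_complex (Y // \<theta>) (Y // \<theta>) (core_quotient Q \<theta>))
    (powerset_complex (Z // \<phi>) (Z // \<phi>) (core_quotient P \<phi>))"
    by (rule tgs_iso_core[OF h(1)]) (simp add: h(2))
  with diagonal_congruence.tgs_iso_diagonal_quotient[OF assms(1)]
    diagonal_congruence.tgs_iso_fibre[OF assms(2)]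
  show ?thesis unfolding tgs_isomorphic_def by (meson tgs_iso_trans)
qed

lemma invariants_if_tgs_isomorphic:
  assumes "diagonal_congruence Y Q \<theta>" "diagonal_congruence Z P \<phi>" "finite (Y // \<theta>)"
    and "tgs_isomorphic (diagonal_quotient Y Q \<theta>) (diagonal_quotient Z P \<phi>)"
  shows "card (Y // \<theta>) = card (Z // \<phi>)"
    "has_left_zero (Y // \<theta>) (Y // \<theta>) (core_quotient Q \<theta>)
      \<Longrightarrow> has_left_zero (Z // \<phi>) (Z // \<phi>) (core_quotient P \<phi>)"
proof -
  obtain f g where iso: "tgs_iso f g (powerset_complex (Y // \<theta>) (Y // \<theta>) (core_quotient Q \<theta>))
    (powerset_complex (Z // \<phi>) (Z // \<phi>) (core_quotient P \<phi>))"
    using diagonal_congruence.tgs_iso_fibre[OF assms(1)] assms(4)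
      diagonal_congruence.tgs_iso_diagonal_quotient[OF assms(2)]
    unfolding tgs_isomorphic_def by (meson tgs_iso_trans)
  then have "bij_betw f (Pow (Y // \<theta>)) (Pow (Z // \<phi>))"
    by (simp add: tgs_iso_def powerset_complex_def)
  then show "card (Y // \<theta>) = card (Z // \<phi>)" using assms(3) by (rule card_eq_if_bij_Pow)
  show "has_left_zero (Y // \<theta>) (Y // \<theta>) (core_quotient Q \<theta>)
      \<Longrightarrow> has_left_zero (Z // \<phi>) (Z // \<phi>) (core_quotient P \<phi>)"
    by (rule has_left_zero_transfer[OF iso])
qed

text \<open>Inverting an isomorphism needs closure of its source. The source is therefore first
  replaced by the powerset complex of the quotient core, where closure is known.\<close>

lemma tgs_isomorphic_diagonal_quotient_sym:
  assumes "diagonal_congruence Y Q \<theta>" "diagonal_congruence Z P \<phi>"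
    and "tgs_isomorphic (diagonal_quotient Y Q \<theta>) (diagonal_quotient Z P \<phi>)"
  shows "tgs_isomorphic (diagonal_quotient Z P \<phi>) (diagonal_quotient Y Q \<theta>)"
proof -
  interpret A: diagonal_congruence Y Q \<theta> by fact
  obtain f g where fg: "tgs_iso f g (powerset_complex (Y // \<theta>) (Y // \<theta>) (core_quotient Q \<theta>))
    (diagonal_quotient Z P \<phi>)"
    using A.tgs_iso_fibre assms(3) unfolding tgs_isomorphic_def by (meson tgs_iso_trans)
  have "\<exists>f' g'. tgs_iso f' g' (diagonal_quotient Z P \<phi>)
      (powerset_complex (Y // \<theta>) (Y // \<theta>) (core_quotient Q \<theta>))"
    using tgs_iso_powerset_complex_sym[OF fg] A.core_quotient_closed by blast
  with A.tgs_iso_fibre show ?thesis unfolding tgs_isomorphic_def by (meson tgs_iso_trans)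
qed

lemma core_isomorphic_refl: "core_isomorphic Y Q Y Q"
  unfolding core_isomorphic_def by (intro exI[of _ id]) simp

text \<open>An automorphism that carries one congruence to the other sends classes to classes by
  taking images.\<close>

lemma core_isomorphic_quotients:
  assumes "diagonal_congruence Y Q \<theta>" "diagonal_congruence Y Q \<phi>"
    and \<sigma>: "bij_betw \<sigma> Y Y"
    and hom: "\<And>a b c d e. \<lbrakk>a \<in> Y; b \<in> Y; c \<in> Y; d \<in> Y; e \<in> Y\<rbrakk>
      \<Longrightarrow> \<sigma> (Q a b c d e) = Q (\<sigma> a) (\<sigma> b) (\<sigma> c) (\<sigma> d) (\<sigma> e)"
    and rel: "\<And>a b. \<lbrakk>a \<in> Y; b \<in> Y\<rbrakk> \<Longrightarrow> (a, b) \<in> \<theta> \<longleftrightarrow> (\<sigma> a, \<sigma> b) \<in> \<phi>"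
  shows "core_isomorphic (Y // \<theta>) (core_quotient Q \<theta>) (Y // \<phi>) (core_quotient Q \<phi>)"
proof -
  interpret A: diagonal_congruence Y Q \<theta> by fact
  interpret B: diagonal_congruence Y Q \<phi> by fact
  have surj: "\<sigma> ` Y = Y" using \<sigma> by (simp add: bij_betw_def)
  have Y: "\<theta> \<subseteq> Y \<times> Y" "\<phi> \<subseteq> Y \<times> Y"
    using A.equiv B.equiv by (auto simp: equiv_def refl_on_def)
  have cls: "\<sigma> ` (\<theta> `` {a}) = \<phi> `` {\<sigma> a}" if "a \<in> Y" for a
  proof (intro equalityI subsetI)
    fix y assume "y \<in> \<phi> `` {\<sigma> a}"
    then have "(\<sigma> a, y) \<in> \<phi>" by simp
    moreover from this Y obtain x where "x \<in> Y" "y = \<sigma> x" using surj by blast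
    ultimately show "y \<in> \<sigma> ` (\<theta> `` {a})" using rel that by auto
  qed (use Y rel that in auto)
  have \<sigma>Y: "\<sigma> a \<in> Y" if "a \<in> Y" for a using that surj by blast
  have "inj_on ((`) \<sigma>) (Pow Y)"
    using \<sigma> by (intro inj_on_image_Pow) (simp add: bij_betw_def)
  then have "inj_on ((`) \<sigma>) (Y // \<theta>)"
    by (rule inj_on_subset) (use Y in \<open>auto simp: quotient_image\<close>)
  moreover have "(`) \<sigma> ` (Y // \<theta>) = Y // \<phi>"
  proof -
    have "(`) \<sigma> ` (Y // \<theta>) = (\<lambda>a. \<phi> `` {\<sigma> a}) ` Y"
      unfolding quotient_image image_image by (rule image_cong[OF refl cls])
    also have "\<dots> = (\<lambda>b. \<phi> `` {b}) ` (\<sigma> ` Y)"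
      by (simp only: image_image)
    finally show ?thesis by (simp only: surj quotient_image)
  qed
  ultimately have bij: "bij_betw ((`) \<sigma>) (Y // \<theta>) (Y // \<phi>)" by (simp add: bij_betw_def)
  have "\<sigma> ` core_quotient Q \<theta> (\<theta> `` {a}) (\<theta> `` {b}) (\<theta> `` {c}) (\<theta> `` {d}) (\<theta> `` {e}) =
      core_quotient Q \<phi> (\<sigma> ` (\<theta> `` {a})) (\<sigma> ` (\<theta> `` {b})) (\<sigma> ` (\<theta> `` {c})) (\<sigma> ` (\<theta> `` {d})) (\<sigma> ` (\<theta> `` {e}))"
    if "a \<in> Y" "b \<in> Y" "c \<in> Y" "d \<in> Y" "e \<in> Y" for a b c d e
    using that by (simp only: A.core_quotient_class B.core_quotient_class cls \<sigma>Y hom A.closed)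
  then show ?thesis
    unfolding core_isomorphic_def quotient_image[of Y \<theta>] ball_simps
    using bij by (intro exI[of _ "(`) \<sigma>"] conjI ballI) (simp_all only: quotient_image)
qed

section \<open>Binary collapses\<close>

lemma atomic_binary_collapse_setwise:
  assumes closed: "\<And>a b. \<lbrakk>a \<in> Z; b \<in> Z\<rbrakk> \<Longrightarrow> n a b \<in> Z"
    and assoc: "\<And>a b c. \<lbrakk>a \<in> Z; b \<in> Z; c \<in> Z\<rbrakk> \<Longrightarrow> n (n a b) c = n a (n b c)"
    and power: "\<And>a b c d e. \<lbrakk>a \<in> Z; b \<in> Z; c \<in> Z; d \<in> Z; e \<in> Z\<rbrakk>
      \<Longrightarrow> n (n (n (n a b) c) d) e = P a b c d e"
  shows "atomic_binary_collapse Z P (\<lambda>A B. \<Union>a\<in>A. \<Union>b\<in>B. {n a b})" (is "atomic_binary_collapse Z P ?s")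
proof -
  have 1: "?s (?s A B) C = ?s A (?s B C)" if "A \<subseteq> Z" "B \<subseteq> Z" "C \<subseteq> Z" for A B C
    unfolding UN_UN_flatten UN_insert UN_empty Un_empty_right
    by (intro SUP_cong refl arg_cong[where f = "\<lambda>x. {x}"] assoc) (use that in auto)
  have 2: "?s (?s (?s (?s A B) C) D) E = setwise P A B C D E"
    if "A \<subseteq> Z" "B \<subseteq> Z" "C \<subseteq> Z" "D \<subseteq> Z" "E \<subseteq> Z" for A B C D E
    unfolding setwise_UN UN_UN_flatten UN_insert UN_empty Un_empty_right
    by (intro SUP_cong refl arg_cong[where f = "\<lambda>x. {x}"] power) (use that in auto)
  have 3: "?s (\<Union>F) B = (\<Union>A\<in>F. ?s A B)" "?s B (\<Union>F) = (\<Union>A\<in>F. ?s B A)" for F B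
    by auto
  have 4: "?s A B \<subseteq> Z" if "A \<subseteq> Z" "B \<subseteq> Z" for A B
    using that closed by auto
  have 5: "\<exists>c\<in>Z. ?s {a} {b} = {c}" if "a \<in> Z" "b \<in> Z" for a b
    using that closed by simp
  show ?thesis
    unfolding atomic_binary_collapse_def by (intro conjI allI ballI impI 1 2 3 4 5)
qed

text \<open>All hypotheses concern representatives modulo \<theta>, so for a concrete finite core
  they can be evaluated. The collapse is the setwise extension of the operation that
  \<open>m\<close> induces on classes.\<close>

lemma (in diagonal_congruence) ex_atomic_binary_collapse:
  assumes mY: "\<And>a b. \<lbrakk>a \<in> Y; b \<in> Y\<rbrakk> \<Longrightarrow> m a b \<in> Y"
    and cong: "\<And>a a' b b'. \<lbrakk>(a, a') \<in> \<theta>; (b, b') \<in> \<theta>\<rbrakk> \<Longrightarrow> (m a b, m a' b') \<in> \<theta>"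
    and assoc: "\<And>a b c. \<lbrakk>a \<in> Y; b \<in> Y; c \<in> Y\<rbrakk> \<Longrightarrow> (m (m a b) c, m a (m b c)) \<in> \<theta>"
    and power: "\<And>a b c d e. \<lbrakk>a \<in> Y; b \<in> Y; c \<in> Y; d \<in> Y; e \<in> Y\<rbrakk>
      \<Longrightarrow> (m (m (m (m a b) c) d) e, Q a b c d e) \<in> \<theta>"
  shows "\<exists>s. atomic_binary_collapse (Y // \<theta>) (core_quotient Q \<theta>) s"
proof -
  define n where "n A B = (\<Union>a\<in>A. \<Union>b\<in>B. \<theta> `` {m a b})" for A B
  have n: "n (\<theta> `` {a}) (\<theta> `` {b}) = \<theta> `` {m a b}" if "a \<in> Y" "b \<in> Y" for a b
    unfolding n_def
    by (intro UN_eq_const class_eq[symmetric] cong)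
      (use that equiv_class_self[OF equiv] in blast)+
  have "atomic_binary_collapse (Y // \<theta>) (core_quotient Q \<theta>) (\<lambda>A B. \<Union>a\<in>A. \<Union>b\<in>B. {n a b})"
  proof (rule atomic_binary_collapse_setwise)
    fix A B assume "A \<in> Y // \<theta>" "B \<in> Y // \<theta>"
    then obtain a b where ab: "a \<in> Y" "b \<in> Y" "A = \<theta> `` {a}" "B = \<theta> `` {b}"
      by (auto elim!: quotientE)
    then show "n A B \<in> Y // \<theta>" by (simp add: n mY quotientI)
    fix C assume "C \<in> Y // \<theta>"
    then obtain c where c: "c \<in> Y" "C = \<theta> `` {c}" by (auto elim!: quotientE)
    with ab class_eq[OF assoc] show "n (n A B) C = n A (n B C)" by (simp add: n mY)
    fix D E assume "D \<in> Y // \<theta>" "E \<in> Y // \<theta>"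
    then obtain d e where "d \<in> Y" "e \<in> Y" "D = \<theta> `` {d}" "E = \<theta> `` {e}"
      by (auto elim!: quotientE)
    with ab c class_eq[OF power]
    show "n (n (n (n A B) C) D) E = core_quotient Q \<theta> A B C D E"
      by (simp add: n mY core_quotient_class)
  qed
  then show ?thesis by blast
qed

lemma (in diagonal_congruence) has_left_zero_core_quotient:
  "has_left_zero (Y // \<theta>) (Y // \<theta>) (core_quotient Q \<theta>) \<longleftrightarrow>
    (\<exists>x\<in>Y. \<forall>a\<in>Y. \<forall>y\<in>Y. \<forall>b\<in>Y. \<forall>z\<in>Y. (Q x a y b z, x) \<in> \<theta>)"
  using eq_equiv_class_iff[OF equiv closed]
  by (simp add: has_left_zero_def quotient_image core_quotient_class cong: bex_cong ball_cong)

section \<open>Order isomorphisms onto a powerset\<close>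

text \<open>The bottom element is defined by choice, so it is first identified as the preimage of
  the empty set; atoms are then the preimages of singletons.\<close>

lemma bij_betw_atoms:
  assumes bij: "bij_betw f D (Pow B)"
    and ord: "\<forall>c\<in>D. \<forall>d\<in>D. c \<sqsubseteq>\<^bsub>pair_inclusion_order D\<^esub> d \<longleftrightarrow> f c \<subseteq> f d"
  shows "bij_betw f {c. is_atom (pair_inclusion_order D) c} ((\<lambda>b. {b}) ` B)"
proof -
  let ?L = "pair_inclusion_order D"
  have carr: "carrier ?L = D" by (simp add: pair_inclusion_order_def)
  have fD: "f c \<subseteq> B" if "c \<in> D" for c using bij that by (auto simp: bij_betw_def)
  have inj: "c = d" if "f c = f d" "c \<in> D" "d \<in> D" for c d
    using that bij by (auto simp: bij_betw_def inj_on_def)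
  have surj: "\<exists>c\<in>D. f c = C" if "C \<subseteq> B" for C
  proof -
    have "C \<in> f ` D" using that bij by (simp add: bij_betw_def)
    then show ?thesis by auto
  qed
  obtain c0 where c0: "c0 \<in> D" "f c0 = {}" using surj[of "{}"] by auto
  have bot: "\<bottom>\<^bsub>?L\<^esub> = c0"
    unfolding bottom_def carr
  proof (rule some_equality)
    show "least ?L c0 D" using c0 ord by (auto simp: least_def carr)
    fix c assume "least ?L c D"
    then have "c \<in> D" "c \<sqsubseteq>\<^bsub>?L\<^esub> c0" using c0 by (auto simp: least_def)
    then show "c = c0" using c0 ord by (intro inj) auto
  qed
  have atom: "is_atom ?L c \<longleftrightarrow> c \<in> D \<and> (\<exists>b\<in>B. f c = {b})" for c
  proof
    assume "is_atom ?L c"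
    then have c: "c \<in> D" "c \<noteq> c0" "\<And>d. d \<in> D \<Longrightarrow> f d \<subseteq> f c \<Longrightarrow> d = c0 \<or> d = c"
      using ord by (auto simp: is_atom_def carr bot)
    then have "f c \<noteq> {}" using c0 inj by metis
    then obtain b where b: "b \<in> f c" by auto
    with fD[OF c(1)] surj[of "{b}"] obtain d where d: "d \<in> D" "f d = {b}" by blast
    with c(3)[of d] b c0 have "d = c" by auto
    with d b fD[OF c(1)] c(1) show "c \<in> D \<and> (\<exists>b\<in>B. f c = {b})" by auto
  next
    assume "c \<in> D \<and> (\<exists>b\<in>B. f c = {b})"
    then obtain b where c: "c \<in> D" "f c = {b}" by auto
    then show "is_atom ?L c"
      unfolding is_atom_def carr bot using c0 ord inj by (auto simp: subset_singleton_iff)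
  qed
  have "inj_on f {c. is_atom ?L c}" using inj atom by (auto intro!: inj_onI)
  moreover have "f ` {c. is_atom ?L c} = (\<lambda>b. {b}) ` B"
  proof (intro equalityI subsetI)
    fix C assume "C \<in> (\<lambda>b. {b}) ` B"
    then obtain b where b: "b \<in> B" "C = {b}" by auto
    with surj[of "{b}"] obtain c where "c \<in> D" "f c = {b}" by blast
    with b atom show "C \<in> f ` {c. is_atom ?L c}" by blast
  qed (use atom in auto)
  ultimately show ?thesis by (simp add: bij_betw_def)
qed

section \<open>The core \<open>H\<^sub>5\<close>\<close>

lemma eps_eta [simp]: "eps (eta s) = s"
  by (cases s) (simp_all add: eps_def eta_def)

lemma eta_neq [simp]: "eta s \<noteq> 1" "eta s \<noteq> 2"
  by (simp_all add: eta_def)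

text \<open>The exceptions respect parity: 1 has parity 0, and 2 has parity 1, which is five times 1
  in Z_2.\<close>

lemma eps_H5: "eps (H5 a b c d e) = eps a + eps b + eps c + eps d + eps e"
  by (simp add: H5_def) (simp add: eps_def)

lemma H5_eq_1_iff: "H5 a b c d e = 1 \<longleftrightarrow> a = 1 \<and> b = 1 \<and> c = 1 \<and> d = 1 \<and> e = 1"
  using eta_neq(1) by (auto simp: H5_def simp del: One_nat_def)

lemma H5_eq_2_iff: "H5 a b c d e = 2 \<longleftrightarrow> a = 2 \<and> b = 2 \<and> c = 2 \<and> d = 2 \<and> e = 2"
  by (auto simp: H5_def)

lemma H5_in_X [simp]: "H5 a b c d e \<in> X"
  by (auto simp: H5_def X_def eta_def)

text \<open>Each side is 1 iff all nine entries are 1, is 2 iff all nine are 2, and is otherwise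
  \<open>eta\<close> of the nine-term parity sum. Hence only the outermost occurrences are
  unfolded.\<close>

lemma H5_assoc:
  "H5 (H5 x a y b z) c u d v = H5 x a (H5 y b z c u) d v"
  "H5 x a (H5 y b z c u) d v = H5 x a y b (H5 z c u d v)"
  unfolding H5_def[of "H5 x a y b z"] H5_def[of x a "H5 y b z c u"] H5_def[of x a y b "H5 z c u d v"]
  by (simp_all only: H5_eq_1_iff H5_eq_2_iff eps_H5 conj_assoc add.assoc)

lemma H5_swap:
  "H5 a u b c d = H5 u a b c d" "H5 a b u c d = H5 u a b c d"
  "H5 a b c u d = H5 u a b c d" "H5 a b c d u = H5 u a b c d"
  unfolding H5_def by (intro if_cong refl arg_cong[where f = eta]; (rule iffI, blast, blast | (simp only: add_ac)))+

lemma no_atomic_binary_collapse_H5: "\<not> atomic_binary_collapse X H5 s"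
proof
  assume s: "atomic_binary_collapse X H5 s"
  then have "\<forall>a\<in>X. \<forall>b\<in>X. \<exists>c\<in>X. s {a} {b} = {c}"
    unfolding atomic_binary_collapse_def by (elim conjE) assumption
  then obtain m where m: "\<And>a b. \<lbrakk>a \<in> X; b \<in> X\<rbrakk> \<Longrightarrow> m a b \<in> X \<and> s {a} {b} = {m a b}"
    by metis
  have s_assoc: "\<forall>A\<subseteq>X. \<forall>B\<subseteq>X. \<forall>C\<subseteq>X. s (s A B) C = s A (s B C)"
    and s_power: "\<forall>A\<subseteq>X. \<forall>B\<subseteq>X. \<forall>C\<subseteq>X. \<forall>D\<subseteq>X. \<forall>E\<subseteq>X.
        s (s (s (s A B) C) D) E = setwise H5 A B C D E"
    using s unfolding atomic_binary_collapse_def by - (elim conjE, assumption)+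
  have assoc: "m (m a b) c = m a (m b c)" if "a \<in> X" "b \<in> X" "c \<in> X" for a b c
    using s_assoc[rule_format, of "{a}" "{b}" "{c}"] that m by simp
  have power: "m (m (m (m a b) c) d) e = H5 a b c d e"
    if "a \<in> X" "b \<in> X" "c \<in> X" "d \<in> X" "e \<in> X" for a b c d e
    using s_power[rule_format, of "{a}" "{b}" "{c}" "{d}" "{e}"] that m by (simp add: setwise_def)
  \<comment> \<open>The ninth power of \<open>a\<close> is \<open>a\<close>, because its fifth power
    is. Read as a five-letter word with first four letters \<open>m a a\<close> and last letter
    \<open>a\<close>, it forces \<open>m a a = a\<close>, since \<open>H5\<close> takes the value
    \<open>a\<close> on no other word of this shape.\<close>
  have idem: "m a a = a"
    if a: "a \<in> X" "H5 a a a a a = a" "\<And>b. H5 b b b b a = a \<Longrightarrow> b = a" for a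
  proof (rule a(3))
    have "H5 (m a a) (m a a) (m a a) (m a a) a = m (m (m (m (m a a) (m a a)) (m a a)) (m a a)) a"
      using a(1) m by (intro power[symmetric]) auto
    also have "\<dots> = m (m (m (m (m (m (m (m a a) a) a) a) a) a) a) a"
      using a(1) m by (simp add: assoc)
    also have "\<dots> = a" using a(1,2) by (simp add: power)
    finally show "H5 (m a a) (m a a) (m a a) (m a a) a = a" .
  qed
  have in_X: "1 \<in> X" "2 \<in> X" by (simp_all add: X_def)
  have one: "m 1 1 = 1" by (rule idem) (simp_all only: in_X H5_eq_1_iff simp_thms)
  have two: "m 2 2 = 2" by (rule idem) (simp_all add: in_X H5_eq_2_iff)
  have "m 1 2 = H5 1 1 1 1 2" using power[of 1 1 1 1 2] by (simp only: in_X one)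
  moreover have "m 1 2 = H5 1 1 1 2 2"
    using power[of 1 1 1 2 2] assoc[of 1 2 2] by (simp only: in_X one two)
  ultimately show False by (simp add: H5_def eps_def eta_def)
qed

section \<open>Strong congruences of the core\<close>

lemma refl_X: "equiv X \<theta> \<Longrightarrow> x \<in> X \<Longrightarrow> (x, x) \<in> \<theta>"
  by (auto simp: equiv_def refl_on_def)

lemma equiv_transD: "equiv X \<theta> \<Longrightarrow> (x, y) \<in> \<theta> \<Longrightarrow> (y, z) \<in> \<theta> \<Longrightarrow> (x, z) \<in> \<theta>"
  by (auto simp: equiv_def dest: transD)

text \<open>An exception can occur only if the four parameters are all 1 or all 2. Otherwise only
  their parity matters, and 4444 and 3444 represent the even and the odd case.\<close>

lemma H5_translate_cases:
  obtains "\<And>u. H5 u a b c d = H5 u 1 1 1 1" | "\<And>u. H5 u a b c d = H5 u 2 2 2 2"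
    | "\<And>u. H5 u a b c d = H5 u 4 4 4 4" | "\<And>u. H5 u a b c d = H5 u 3 4 4 4"
proof (cases "a = 1 \<and> b = 1 \<and> c = 1 \<and> d = 1 \<or> a = 2 \<and> b = 2 \<and> c = 2 \<and> d = 2")
  case True
  then show ?thesis using that(1,2) by auto
next
  case False
  have H: "H5 u a b c d = eta (eps u + (eps a + eps b + eps c + eps d))" for u
  proof -
    have "\<not> (u = 1 \<and> a = 1 \<and> b = 1 \<and> c = 1 \<and> d = 1)" "\<not> (u = 2 \<and> a = 2 \<and> b = 2 \<and> c = 2 \<and> d = 2)"
      using False by blast+
    then show ?thesis by (simp only: H5_def if_False add.assoc)
  qed
  have *: "H5 u 4 4 4 4 = eta (eps u + 0)" "H5 u 3 4 4 4 = eta (eps u + 1)" for u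
    by (simp_all add: H5_def eps_def)
  show ?thesis
  proof (cases "eps a + eps b + eps c + eps d")
    case zero
    then show ?thesis by (intro that(3)) (simp only: H *)
  next
    case one
    then show ?thesis by (intro that(4)) (simp only: H *)
  qed
qed

definition compatible :: "(nat \<times> nat) set \<Rightarrow> (nat \<times> nat) set \<Rightarrow> bool" where
  "compatible \<theta> \<phi> \<longleftrightarrow> (\<forall>(u, v)\<in>\<phi>. (H5 u 1 1 1 1, H5 v 1 1 1 1) \<in> \<theta> \<and>
     (H5 u 2 2 2 2, H5 v 2 2 2 2) \<in> \<theta> \<and> (H5 u 4 4 4 4, H5 v 4 4 4 4) \<in> \<theta> \<and>
     (H5 u 3 4 4 4, H5 v 3 4 4 4) \<in> \<theta>)"

lemma compatibleD:
  assumes "compatible \<theta> \<phi>" "(u, v) \<in> \<phi>"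
  shows "(H5 u a b c d, H5 v a b c d) \<in> \<theta>"
proof -
  note * = bspec[OF assms(1)[unfolded compatible_def] assms(2), unfolded prod.case]
  show ?thesis by (rule H5_translate_cases[of a b c d]) (use * in simp_all)
qed

text \<open>Related tuples are linked by changing one entry at a time, with symmetry moving that
  entry to the front. Carrier slots require \<open>compatible \<theta> \<theta>\<close>, index slots
  \<open>compatible \<theta> \<phi>\<close>.\<close>

lemma strong_frame_congruence_H5_iff:
  "strong_frame_congruence X X H5 \<theta> \<phi> \<longleftrightarrow>
    equiv X \<theta> \<and> equiv X \<phi> \<and> compatible \<theta> \<theta> \<and> compatible \<theta> \<phi>"
proof (intro iffI conjI)
  assume strong: "strong_frame_congruence X X H5 \<theta> \<phi>"
  then show eqs: "equiv X \<theta>" "equiv X \<phi>" by (simp_all add: strong_frame_congruence_def)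
  have r: "(1, 1) \<in> \<theta>" "(2, 2) \<in> \<theta>" "(3, 3) \<in> \<theta>" "(4, 4) \<in> \<theta>"
    "(1, 1) \<in> \<phi>" "(2, 2) \<in> \<phi>" "(3, 3) \<in> \<phi>" "(4, 4) \<in> \<phi>"
    using refl_X[OF eqs(1)] refl_X[OF eqs(2)] by (auto simp: X_def)
  show "compatible \<theta> \<theta>"
    unfolding compatible_def
    by (intro ballI) (auto intro!: strong_frame_congruenceD[OF strong] simp: r simp del: One_nat_def)
  \<comment> \<open>The varying entry is placed in an index slot so that it may range over \<phi>;
    symmetry then turns these maps into the translations of \<open>compatible\<close>.\<close>
  have "(H5 1 u 1 1 1, H5 1 v 1 1 1) \<in> \<theta> \<and> (H5 2 u 2 2 2, H5 2 v 2 2 2) \<in> \<theta> \<and>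
      (H5 4 u 4 4 4, H5 4 v 4 4 4) \<in> \<theta> \<and> (H5 3 u 4 4 4, H5 3 v 4 4 4) \<in> \<theta>" if "(u, v) \<in> \<phi>" for u v
    using that by (auto intro!: strong_frame_congruenceD[OF strong] simp: r simp del: One_nat_def)
  then show "compatible \<theta> \<phi>"
    unfolding compatible_def H5_swap(1)[of 1] H5_swap(1)[of 2] H5_swap(1)[of 3] H5_swap(1)[of 4] by blast
next
  assume comp: "equiv X \<theta> \<and> equiv X \<phi> \<and> compatible \<theta> \<theta> \<and> compatible \<theta> \<phi>"
  then have t: "\<And>x y z. (x, y) \<in> \<theta> \<Longrightarrow> (y, z) \<in> \<theta> \<Longrightarrow> (x, z) \<in> \<theta>"
    using equiv_transD by blast
  have "(H5 x a y b z, H5 x' a' y' b' z') \<in> \<theta>"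
    if "(x, x') \<in> \<theta>" "(a, a') \<in> \<phi>" "(y, y') \<in> \<theta>" "(b, b') \<in> \<phi>" "(z, z') \<in> \<theta>"
    for x x' a a' y y' b b' z z'
  proof -
    have s1: "(H5 x a y b z, H5 x' a y b z) \<in> \<theta>" using comp that(1) compatibleD by blast
    have s2: "(H5 x' a y b z, H5 x' a' y b z) \<in> \<theta>"
      unfolding H5_swap(1)[of x' a] H5_swap(1)[of x' a'] using comp that(2) compatibleD by blast
    have s3: "(H5 x' a' y b z, H5 x' a' y' b z) \<in> \<theta>"
      unfolding H5_swap(2)[of x' a' y] H5_swap(2)[of x' a' y'] using comp that(3) compatibleD by blast
    have s4: "(H5 x' a' y' b z, H5 x' a' y' b' z) \<in> \<theta>"
      unfolding H5_swap(3)[of x' a' y' b] H5_swap(3)[of x' a' y' b'] using comp that(4) compatibleD by blast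
    have s5: "(H5 x' a' y' b' z, H5 x' a' y' b' z') \<in> \<theta>"
      unfolding H5_swap(4)[of x' a' y' b' z] H5_swap(4)[of x' a' y' b' z'] using comp that(5) compatibleD by blast
    show ?thesis by (rule t[OF s1 t[OF s2 t[OF s3 t[OF s4 s5]]]])
  qed
  with comp show "strong_frame_congruence X X H5 \<theta> \<phi>"
    by (auto simp: strong_frame_congruence_def)
qed

text \<open>An equivalence on \<open>X\<close> is encoded by the list whose entry at index \<open>x - 1\<close> is the least
  element of the class of \<open>x\<close>.\<close>

definition partition_labels :: "nat list list" where
  "partition_labels =
     filter (\<lambda>r. \<forall>x\<in>set r. r ! (x - 1) = x) (product_lists [[1], [1, 2], [1, 2, 3], [1, 2, 3, 4]])"

definition label_rel :: "nat list \<Rightarrow> (nat \<times> nat) set" where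
  "label_rel r = {(x, y). x \<in> X \<and> y \<in> X \<and> r ! (x - 1) = r ! (y - 1)}"

lemma equiv_label_rel: "equiv X (label_rel r)"
  by (auto simp: equiv_def refl_on_def sym_def trans_def label_rel_def)

text \<open>Least representatives satisfy \<open>rep x \<le> x\<close> and
  \<open>rep (rep x) = rep x\<close>. The first puts the list into the product of candidate lists,
  the second is the filter condition.\<close>

lemma equiv_X_cases:
  assumes "equiv X \<theta>"
  shows "\<exists>r\<in>set partition_labels. \<theta> = label_rel r"
proof -
  define rep where "rep x = Min (\<theta> `` {x})" for x
  have sub: "\<theta> \<subseteq> X \<times> X" using assms by (auto simp: equiv_def refl_on_def)
  have rep: "(x, rep x) \<in> \<theta>" "rep x \<in> X" "rep x \<le> x" if "x \<in> X" for x
  proof -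
    have "finite (\<theta> `` {x})" by (rule finite_subset[of _ X]) (use sub in \<open>auto simp: X_def\<close>)
    moreover have "x \<in> \<theta> `` {x}" using equiv_class_self[OF assms that] .
    ultimately have "rep x \<in> \<theta> `` {x}" "rep x \<le> x"
      unfolding rep_def using Min_in[of "\<theta> `` {x}"] Min_le[of "\<theta> `` {x}" x] by blast+
    then show "(x, rep x) \<in> \<theta>" "rep x \<in> X" "rep x \<le> x" using sub by auto
  qed
  have rep_eq: "rep x = rep y \<longleftrightarrow> (x, y) \<in> \<theta>" if "x \<in> X" "y \<in> X" for x y
  proof
    assume "rep x = rep y"
    then show "(x, y) \<in> \<theta>"
      using rep(1)[OF that(1)] rep(1)[OF that(2)] assms by (auto simp: equiv_def dest: symD transD)
  next
    assume "(x, y) \<in> \<theta>"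
    then show "rep x = rep y" using equiv_class_eq[OF assms] by (simp add: rep_def)
  qed
  let ?r = "[rep 1, rep 2, rep 3, rep 4]"
  have nth: "?r ! (x - 1) = rep x" if "x \<in> X" for x
    using that by (auto simp: X_def)
  have "\<theta> = label_rel ?r"
    using sub nth rep_eq by (auto simp: label_rel_def)
  moreover have "?r \<in> set partition_labels"
  proof -
    have "rep 1 \<in> {1}" "rep 2 \<in> {1, 2}" "rep 3 \<in> {1, 2, 3}" "rep 4 \<in> {1, 2, 3, 4}"
      using rep(2,3)[of 1] rep(2,3)[of 2] rep(2,3)[of 3] rep(2,3)[of 4] by (auto simp: X_def)
    then have "?r \<in> set (product_lists [[1], [1, 2], [1, 2, 3], [1, 2, 3, 4]])"
      unfolding product_lists_set by simp
    moreover have "?r ! (x - 1) = x" if "x \<in> set ?r" for x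
    proof -
      have "x \<in> rep ` X" using that by (simp add: X_def)
      then obtain y where y: "y \<in> X" "x = rep y" by blast
      with rep[OF y(1)] rep_eq[of y "rep y"] nth[of x] show ?thesis by simp
    qed
    ultimately show ?thesis by (simp only: partition_labels_def set_filter mem_Collect_eq) blast
  qed
  ultimately show ?thesis by blast
qed

text \<open>Labels by least representatives are canonical, so counting lists counts
  equivalences.\<close>

lemma label_rel_inj: "inj_on label_rel (set partition_labels)"
proof -
  have all: "\<forall>r\<in>set partition_labels. \<forall>s\<in>set partition_labels.
      (\<forall>x\<in>{1, 2, 3, 4}. \<forall>y\<in>{1, 2, 3, 4}. (r ! (x - 1) = r ! (y - 1)) = (s ! (x - 1) = s ! (y - 1))) \<longrightarrow> r = s"
    by code_simp
  show ?thesis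
  proof (rule inj_onI)
    fix r s assume rs: "r \<in> set partition_labels" "s \<in> set partition_labels" "label_rel r = label_rel s"
    have "(r ! (x - 1) = r ! (y - 1)) = (s ! (x - 1) = s ! (y - 1))"
      if "x \<in> {1, 2, 3, 4}" "y \<in> {1, 2, 3, 4}" for x y
    proof -
      have "(x, y) \<in> label_rel r \<longleftrightarrow> (x, y) \<in> label_rel s" using rs(3) by simp
      then show ?thesis using that by (simp only: label_rel_def X_def mem_Collect_eq prod.case simp_thms)
    qed
    with all rs(1,2) show "r = s" by blast
  qed
qed

text \<open>Value tables of the four translations, in the order of \<open>compatible\<close>. With
  them, compatibility is evaluated by list lookups instead of by unfolding
  \<open>H5\<close>.\<close>

definition translates :: "nat list list" where
  "translates = [[1, 3, 3, 4], [4, 2, 3, 4], [4, 3, 3, 4], [3, 4, 4, 3]]"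

lemma translates_H5:
  assumes "x \<in> X"
  shows "map (\<lambda>t. t ! (x - 1)) translates = [H5 x 1 1 1 1, H5 x 2 2 2 2, H5 x 4 4 4 4, H5 x 3 4 4 4]"
  using assms by (auto simp: X_def translates_def H5_def eps_def eta_def)

definition labels_compatible :: "nat list \<Rightarrow> nat list \<Rightarrow> bool" where
  "labels_compatible r s \<longleftrightarrow> (\<forall>x\<in>{1, 2, 3, 4}. \<forall>y\<in>{1, 2, 3, 4}. s ! (x - 1) = s ! (y - 1) \<longrightarrow>
     (\<forall>t\<in>set translates. r ! (t ! (x - 1) - 1) = r ! (t ! (y - 1) - 1)))"

lemma compatible_label_rel_iff: "compatible (label_rel r) (label_rel s) \<longleftrightarrow> labels_compatible r s"
proof -
  have "(\<forall>t\<in>set translates. r ! (t ! (x - 1) - 1) = r ! (t ! (y - 1) - 1)) \<longleftrightarrow>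
      (H5 x 1 1 1 1, H5 y 1 1 1 1) \<in> label_rel r \<and> (H5 x 2 2 2 2, H5 y 2 2 2 2) \<in> label_rel r \<and>
      (H5 x 4 4 4 4, H5 y 4 4 4 4) \<in> label_rel r \<and> (H5 x 3 4 4 4, H5 y 3 4 4 4) \<in> label_rel r"
    if "x \<in> X" "y \<in> X" for x y
    using translates_H5[OF that(1)] translates_H5[OF that(2)]
    by (simp add: translates_def label_rel_def)
  then show ?thesis
    unfolding compatible_def labels_compatible_def X_def[symmetric] by (auto simp: label_rel_def)
qed

section \<open>Counting the strong pairs\<close>

definition strong_labels :: "(nat list \<times> nat list) list" where
  "strong_labels = [(r, s). r \<leftarrow> partition_labels, labels_compatible r r,
     s \<leftarrow> partition_labels, labels_compatible r s]"

lemma strong_frame_congruences_H5: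
  "{(\<theta>, \<phi>). strong_frame_congruence X X H5 \<theta> \<phi>} = map_prod label_rel label_rel ` set strong_labels"
proof -
  have "set strong_labels = {(r, s). r \<in> set partition_labels \<and> s \<in> set partition_labels \<and>
      labels_compatible r r \<and> labels_compatible r s}"
    by (auto simp: strong_labels_def)
  moreover have "strong_frame_congruence X X H5 \<theta> \<phi> \<longleftrightarrow>
      (\<exists>r\<in>set partition_labels. \<exists>s\<in>set partition_labels. \<theta> = label_rel r \<and> \<phi> = label_rel s \<and>
        labels_compatible r r \<and> labels_compatible r s)" for \<theta> \<phi>
    unfolding strong_frame_congruence_H5_iff
    using equiv_X_cases equiv_label_rel compatible_label_rel_iff by metis
  ultimately show ?thesis by fastforce
qed

lemma card_strong_frame_congruences_H5:
  "card {(\<theta>, \<phi>). strong_frame_congruence X X H5 \<theta> \<phi>} = 36"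
proof -
  have "set strong_labels \<subseteq> set partition_labels \<times> set partition_labels"
    by (auto simp: strong_labels_def)
  then have "inj_on (map_prod label_rel label_rel) (set strong_labels)"
    using map_prod_inj_on[OF label_rel_inj label_rel_inj] by (rule inj_on_subset[rotated])
  moreover have "distinct strong_labels" "length strong_labels = 36" by code_simp+
  ultimately show ?thesis
    by (simp add: strong_frame_congruences_H5 card_image distinct_card)
qed

lemma induces_strong_H5: "induces_strong X X H5 \<theta> \<phi> \<longleftrightarrow> strong_frame_congruence X X H5 \<theta> \<phi>"
  by (rule induces_strong_iff) simp

lemma card_strong_atom_saturated_pairs_H5: "card (strong_atom_saturated_pairs X X H5) = 36"
proof -
  have "strong_atom_saturated_pairs X X H5 =
      map_prod (saturated X) (saturated X) ` {(\<theta>, \<phi>). strong_frame_congruence X X H5 \<theta> \<phi>}"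
    by (auto simp: strong_atom_saturated_pairs_def induces_strong_H5)
  moreover have "inj_on (map_prod (saturated X) (saturated X))
      {(\<theta>, \<phi>). strong_frame_congruence X X H5 \<theta> \<phi>}"
    by (rule inj_onI) (auto simp: strong_frame_congruence_def saturated_eq_iff)
  ultimately show ?thesis
    by (simp add: card_image card_strong_frame_congruences_H5)
qed

section \<open>The diagonal congruences and their Boolean lattice\<close>

definition diagonal_labels :: "nat list list" where
  "diagonal_labels = [[1, 1, 1, 1], [1, 2, 1, 1], [1, 2, 2, 1], [1, 2, 2, 2], [1, 2, 2, 4],
     [1, 2, 3, 1], [1, 2, 3, 3], [1, 2, 3, 4]]"

lemma diagonal_labels_eq: "diagonal_labels = filter (\<lambda>r. labels_compatible r r) partition_labels"
  by code_simp

lemma diagonal_congruences_H5: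
  "{\<theta>. strong_frame_congruence X X H5 \<theta> \<theta>} = label_rel ` set diagonal_labels"
proof -
  have "strong_frame_congruence X X H5 \<theta> \<theta> \<longleftrightarrow>
      (\<exists>r\<in>set partition_labels. \<theta> = label_rel r \<and> labels_compatible r r)" for \<theta>
    unfolding strong_frame_congruence_H5_iff
    using equiv_X_cases equiv_label_rel compatible_label_rel_iff by metis
  then show ?thesis by (auto simp: diagonal_labels_eq)
qed

lemma diagonal_labels_inj: "inj_on label_rel (set diagonal_labels)"
  by (rule inj_on_subset[OF label_rel_inj]) (auto simp: diagonal_labels_eq)

lemma label_rel_named:
  "label_rel [1, 1, 1, 1] = eq_nabla" "label_rel [1, 2, 1, 1] = eq_alpha"
  "label_rel [1, 2, 2, 1] = eq_pi" "label_rel [1, 2, 2, 2] = eq_beta"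
  "label_rel [1, 2, 2, 4] = eq_lambda" "label_rel [1, 2, 3, 1] = eq_mu"
  "label_rel [1, 2, 3, 3] = eq_nu" "label_rel [1, 2, 3, 4] = Id_on X"
proof -
  have eq: "label_rel r = S"
    if "S \<subseteq> X \<times> X" "\<forall>x\<in>X. \<forall>y\<in>X. (x, y) \<in> S \<longleftrightarrow> r ! (x - 1) = r ! (y - 1)" for r S
    using that by (auto simp: label_rel_def)
  have sub: "of_blocks P \<subseteq> X \<times> X" if "\<Union>P \<subseteq> X" for P
    using that by (auto simp: of_blocks_def)
  show "label_rel [1, 1, 1, 1] = eq_nabla" "label_rel [1, 2, 1, 1] = eq_alpha"
    "label_rel [1, 2, 2, 1] = eq_pi" "label_rel [1, 2, 2, 2] = eq_beta"
    "label_rel [1, 2, 2, 4] = eq_lambda" "label_rel [1, 2, 3, 1] = eq_mu"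
    "label_rel [1, 2, 3, 3] = eq_nu"
    unfolding eq_nabla_def eq_alpha_def eq_pi_def eq_beta_def eq_lambda_def eq_mu_def eq_nu_def
    by (rule eq[OF sub]; simp add: X_def; simp add: of_blocks_def)+
  show "label_rel [1, 2, 3, 4] = Id_on X"
    by (rule eq) (auto simp: X_def)
qed

text \<open>Each diagonal congruence is a join of \<open>\<lambda>\<close>, \<open>\<mu>\<close>, \<open>\<nu>\<close>, which identify the pairs
  \<open>2, 3\<close> and \<open>1, 4\<close> and \<open>3, 4\<close> respectively.\<close>

definition atoms_below :: "(nat \<times> nat) set \<Rightarrow> nat set" where
  "atoms_below \<theta> = (if (2, 3) \<in> \<theta> then {1} else {}) \<union> (if (1, 4) \<in> \<theta> then {2} else {}) \<union>
     (if (3, 4) \<in> \<theta> then {3} else {})"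

lemma atoms_below_subset_iff:
  "atoms_below \<theta> \<subseteq> atoms_below \<phi> \<longleftrightarrow> ((2, 3) \<in> \<theta> \<longrightarrow> (2, 3) \<in> \<phi>) \<and>
    ((1, 4) \<in> \<theta> \<longrightarrow> (1, 4) \<in> \<phi>) \<and> ((3, 4) \<in> \<theta> \<longrightarrow> (3, 4) \<in> \<phi>)"
  by (simp add: atoms_below_def)

text \<open>Evaluation over the eight lists shows that the three pairs tested by
  \<open>atoms_below\<close> already decide inclusion.\<close>

lemma diagonal_subset_iff:
  assumes "r \<in> set diagonal_labels" "s \<in> set diagonal_labels"
  shows "label_rel r \<subseteq> label_rel s \<longleftrightarrow> atoms_below (label_rel r) \<subseteq> atoms_below (label_rel s)"
proof
  assume sub: "atoms_below (label_rel r) \<subseteq> atoms_below (label_rel s)"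
  have all: "\<forall>r\<in>set diagonal_labels. \<forall>s\<in>set diagonal_labels.
    (r ! 1 = r ! 2 \<longrightarrow> s ! 1 = s ! 2) \<and> (r ! 0 = r ! 3 \<longrightarrow> s ! 0 = s ! 3) \<and>
    (r ! 2 = r ! 3 \<longrightarrow> s ! 2 = s ! 3) \<longrightarrow>
    (\<forall>x\<in>{1, 2, 3, 4}. \<forall>y\<in>{1, 2, 3, 4}. r ! (x - 1) = r ! (y - 1) \<longrightarrow> s ! (x - 1) = s ! (y - 1))"
    by code_simp
  have "(r ! 1 = r ! 2 \<longrightarrow> s ! 1 = s ! 2) \<and> (r ! 0 = r ! 3 \<longrightarrow> s ! 0 = s ! 3) \<and>
    (r ! 2 = r ! 3 \<longrightarrow> s ! 2 = s ! 3)"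
    using sub by (simp add: atoms_below_subset_iff label_rel_def X_def)
  then have "\<forall>x\<in>X. \<forall>y\<in>X. r ! (x - 1) = r ! (y - 1) \<longrightarrow> s ! (x - 1) = s ! (y - 1)"
    using all assms unfolding X_def by blast
  then show "label_rel r \<subseteq> label_rel s" by (auto simp: label_rel_def)
qed (auto simp: atoms_below_subset_iff)

text \<open>Injectivity follows from reflecting inclusion. Surjectivity is by counting: eight
  distinct values in a powerset of eight elements.\<close>

lemma bij_betw_atoms_below:
  "bij_betw atoms_below {\<theta>. strong_frame_congruence X X H5 \<theta> \<theta>} (Pow {1, 2, 3})"
  unfolding bij_betw_def
proof
  show inj: "inj_on atoms_below {\<theta>. strong_frame_congruence X X H5 \<theta> \<theta>}"
    unfolding diagonal_congruences_H5
    by (rule inj_onI) (use diagonal_subset_iff in blast)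
  have "distinct diagonal_labels" "length diagonal_labels = 8" by code_simp+
  then have "card {\<theta>. strong_frame_congruence X X H5 \<theta> \<theta>} = 8"
    by (simp add: diagonal_congruences_H5 card_image[OF diagonal_labels_inj] distinct_card)
  then have "card (atoms_below ` {\<theta>. strong_frame_congruence X X H5 \<theta> \<theta>}) = card (Pow {1, 2, 3 :: nat})"
    by (simp add: card_image[OF inj] card_Pow)
  then show "atoms_below ` {\<theta>. strong_frame_congruence X X H5 \<theta> \<theta>} = Pow {1, 2, 3}"
    by (intro card_subset_eq) (auto simp: atoms_below_def split: if_splits)
qed

lemma diagonal_lattice:
  "\<exists>f. bij_betw f (diagonal_pairs X H5) (Pow {1, 2, 3 :: nat}) \<and>
    (\<forall>c\<in>diagonal_pairs X H5. \<forall>d\<in>diagonal_pairs X H5.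
      c \<sqsubseteq>\<^bsub>pair_inclusion_order (diagonal_pairs X H5)\<^esub> d \<longleftrightarrow> f c \<subseteq> f d)"
proof -
  let ?D = "{\<theta>. strong_frame_congruence X X H5 \<theta> \<theta>}"
  let ?p = "\<lambda>\<theta>. (saturated X \<theta>, saturated X \<theta>)"
  have D: "equiv X \<theta>" if "\<theta> \<in> ?D" for \<theta> using that by (simp add: strong_frame_congruence_def)
  have pairs: "diagonal_pairs X H5 = ?p ` ?D"
    by (auto simp: diagonal_pairs_def induces_strong_H5)
  have p: "bij_betw ?p ?D (diagonal_pairs X H5)"
    unfolding pairs by (rule bij_betw_imageI, rule inj_onI) (use D saturated_eq_iff in blast)+
  let ?f = "atoms_below \<circ> inv_into ?D ?p"
  have f: "?f (?p \<theta>) = atoms_below \<theta>" if "\<theta> \<in> ?D" for \<theta>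
    using bij_betw_inv_into_left[OF p that] by simp
  have "bij_betw ?f (diagonal_pairs X H5) (Pow {1, 2, 3})"
    by (rule bij_betw_trans[OF bij_betw_inv_into[OF p] bij_betw_atoms_below])
  moreover have "?p \<theta> \<sqsubseteq>\<^bsub>pair_inclusion_order (diagonal_pairs X H5)\<^esub> ?p \<phi> \<longleftrightarrow> ?f (?p \<theta>) \<subseteq> ?f (?p \<phi>)"
    if "\<theta> \<in> ?D" "\<phi> \<in> ?D" for \<theta> \<phi>
  proof -
    have "\<theta> \<subseteq> \<phi> \<longleftrightarrow> atoms_below \<theta> \<subseteq> atoms_below \<phi>"
      using that diagonal_subset_iff unfolding diagonal_congruences_H5 by blast
    then show ?thesis
      unfolding f[OF that(1)] f[OF that(2)]
      using saturated_subset_iff[OF D[OF that(1)] D[OF that(2)]] by (simp add: pair_inclusion_order_def)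
  qed
  ultimately show ?thesis unfolding pairs by blast
qed

section \<open>The proper diagonal quotients\<close>

definition swap :: "nat \<Rightarrow> nat" where
  "swap x = (if x = 1 then 2 else if x = 2 then 1 else if x = 3 then 4 else 3)"

lemma bij_betw_swap: "bij_betw swap X X"
  by (rule bij_betw_byWitness[of _ swap]) (auto simp: X_def swap_def)

lemma swap_H5:
  assumes "a \<in> X" "b \<in> X" "c \<in> X" "d \<in> X" "e \<in> X"
  shows "swap (H5 a b c d e) = H5 (swap a) (swap b) (swap c) (swap d) (swap e)"
proof -
  have one: "swap x = 1 \<longleftrightarrow> x = 2" and two: "swap x = 2 \<longleftrightarrow> x = 1" and eps: "eps (swap x) = 1 + eps x"
    if "x \<in> X" for x
    using that by (auto simp: X_def swap_def eps_def)
  have eta: "swap (eta s) = eta (1 + s)" for s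
    by (cases s) (simp_all add: swap_def eta_def)
  \<comment> \<open>Shifting all five parities by 1 shifts the sum by 5, which is 1 in Z_2; the swap
    is an automorphism because 5 is odd.\<close>
  have flip: "eta (1 + (s + t + u + v + w)) = eta ((1 + s) + (1 + t) + (1 + u) + (1 + v) + (1 + w))" for s t u v w
    by (cases s; cases t; cases u; cases v; cases w; simp)
  have vals: "swap 1 = 2" "swap 2 = 1" by (simp_all add: swap_def)
  show ?thesis
    unfolding H5_def one[OF assms(1)] one[OF assms(2)] one[OF assms(3)] one[OF assms(4)] one[OF assms(5)]
      two[OF assms(1)] two[OF assms(2)] two[OF assms(3)] two[OF assms(4)] two[OF assms(5)]
      eps[OF assms(1)] eps[OF assms(2)] eps[OF assms(3)] eps[OF assms(4)] eps[OF assms(5)]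
      flip[symmetric] eta[symmetric]
    by (auto simp: vals simp del: One_nat_def)
qed

definition proper_labels :: "nat list list" where
  "proper_labels = [[1, 1, 1, 1], [1, 2, 1, 1], [1, 2, 2, 1], [1, 2, 2, 2], [1, 2, 2, 4],
     [1, 2, 3, 1], [1, 2, 3, 3]]"

lemma diagonal_labels_Cons: "set diagonal_labels = insert [1, 2, 3, 4] (set proper_labels)"
  by (simp add: diagonal_labels_def proper_labels_def insert_commute)

lemma proper_diagonal_H5: "proper_diagonal X H5 = label_rel ` set proper_labels"
proof -
  have "label_rel r \<noteq> Id_on X" if "r \<in> set proper_labels" for r
  proof
    assume "label_rel r = Id_on X"
    then have "r = [1, 2, 3, 4]"
      using that by (intro inj_onD[OF diagonal_labels_inj])
        (simp_all add: label_rel_named diagonal_labels_Cons del: One_nat_def)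
    with that show False by (simp add: proper_labels_def)
  qed
  moreover have "proper_diagonal X H5 = label_rel ` set diagonal_labels - {Id_on X}"
    by (auto simp: proper_diagonal_def induces_strong_H5 simp flip: diagonal_congruences_H5)
  ultimately show ?thesis
    by (auto simp: diagonal_labels_Cons label_rel_named simp del: One_nat_def)
qed

lemma diagonal_congruence_H5:
  "\<theta> \<in> proper_diagonal X H5 \<Longrightarrow> diagonal_congruence X H5 \<theta>"
  by (simp add: proper_diagonal_def induces_strong_H5 diagonal_congruence_def)

section \<open>Invariants of the proper quotients\<close>

definition labels_left_zero :: "nat list \<Rightarrow> bool" where
  "labels_left_zero r \<longleftrightarrow>
     (\<exists>x\<in>{1, 2, 3, 4}. \<forall>t\<in>set translates. r ! (t ! (x - 1) - 1) = r ! (x - 1))"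

text \<open>The parameters act only through the four translations, so a left zero is a class that
  contains the images of its representative under all four.\<close>

lemma has_left_zero_H5_quotient:
  assumes "diagonal_congruence X H5 (label_rel r)"
  shows "has_left_zero (X // label_rel r) (X // label_rel r) (core_quotient H5 (label_rel r)) \<longleftrightarrow>
    labels_left_zero r"
proof -
  have "(\<forall>a\<in>X. \<forall>y\<in>X. \<forall>b\<in>X. \<forall>z\<in>X. (H5 x a y b z, x) \<in> label_rel r) \<longleftrightarrow>
      (\<forall>t\<in>set translates. r ! (t ! (x - 1) - 1) = r ! (x - 1))" (is "?L \<longleftrightarrow> ?R") if "x \<in> X" for x
  proof -
    have "?R \<longleftrightarrow> (H5 x 1 1 1 1, x) \<in> label_rel r \<and> (H5 x 2 2 2 2, x) \<in> label_rel r \<and>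
        (H5 x 4 4 4 4, x) \<in> label_rel r \<and> (H5 x 3 4 4 4, x) \<in> label_rel r" (is "_ \<longleftrightarrow> ?M")
      using translates_H5[OF that] that by (simp add: translates_def label_rel_def)
    also have "?M \<longleftrightarrow> ?L"
    proof
      assume M: ?M
      have "(H5 x a y b z, x) \<in> label_rel r" for a y b z
        by (rule H5_translate_cases[of a y b z]) (use M in simp_all)
      then show ?L by blast
    next
      assume L: ?L
      have "1 \<in> X" "2 \<in> X" "3 \<in> X" "4 \<in> X" by (simp_all add: X_def)
      with L show ?M by blast
    qed
    finally show ?thesis by blast
  qed
  then show ?thesis
    unfolding diagonal_congruence.has_left_zero_core_quotient[OF assms] labels_left_zero_def X_def[symmetric]
    by (intro bex_cong refl)
qed

lemma card_quotient_label_rel: "card (X // label_rel r) = card {r ! 0, r ! 1, r ! 2, r ! 3}"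
proof -
  define F where "F v = {y \<in> X. r ! (y - 1) = v}" for v
  have "label_rel r `` {x} = F (r ! (x - 1))" if "x \<in> X" for x
    using that by (auto simp: label_rel_def F_def)
  then have "X // label_rel r = (\<lambda>x. F (r ! (x - 1))) ` X"
    unfolding quotient_image by (rule image_cong[OF refl])
  also have "\<dots> = F ` (\<lambda>x. r ! (x - 1)) ` X" by (simp only: image_image)
  finally have "card (X // label_rel r) = card (F ` (\<lambda>x. r ! (x - 1)) ` X)" by simp
  also have "\<dots> = card ((\<lambda>x. r ! (x - 1)) ` X)"
    \<comment> \<open>Every label that occurs has a non-empty class, so different labels give
      different classes.\<close>
    by (rule card_image, rule inj_onI) (auto simp: F_def set_eq_iff)
  also have "(\<lambda>x. r ! (x - 1)) ` X = {r ! 0, r ! 1, r ! 2, r ! 3}"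
    by (simp add: X_def)
  finally show ?thesis .
qed

text \<open>The values are (1, True) for \<nabla>, (2, True) for \<alpha> and \<beta>, (2, False)
  for \<pi>, (3, False) for \<lambda> and \<mu>, and (3, True) for \<nu>.\<close>

definition labels_kind :: "nat list \<Rightarrow> nat \<times> bool" where
  "labels_kind r = (card {r ! 0, r ! 1, r ! 2, r ! 3}, labels_left_zero r)"

lemma same_kind_cases:
  "\<forall>r\<in>set proper_labels. \<forall>s\<in>set proper_labels. labels_kind r = labels_kind s \<longrightarrow> r = s \<or>
    (\<forall>a\<in>{1, 2, 3, 4}. \<forall>b\<in>{1, 2, 3, 4}. r ! (a - 1) = r ! (b - 1) \<longleftrightarrow> s ! (swap a - 1) = s ! (swap b - 1))"
  by code_simp

lemma same_kind_if_tgs_isomorphic: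
  assumes rs: "r \<in> set proper_labels" "s \<in> set proper_labels"
    and iso: "tgs_isomorphic (diagonal_quotient X H5 (label_rel r)) (diagonal_quotient X H5 (label_rel s))"
  shows "labels_kind r = labels_kind s"
proof -
  have cong: "diagonal_congruence X H5 (label_rel r)" "diagonal_congruence X H5 (label_rel s)"
    using rs by (auto intro!: diagonal_congruence_H5 simp: proper_diagonal_H5)
  have fin: "finite (X // label_rel t)" for t
    by (simp add: quotient_image X_def)
  \<comment> \<open>A left zero is transferred only from source to target, so equivalence needs the
    reverse isomorphism as well.\<close>
  have "tgs_isomorphic (diagonal_quotient X H5 (label_rel s)) (diagonal_quotient X H5 (label_rel r))"
    using cong iso by (rule tgs_isomorphic_diagonal_quotient_sym)
  then have "labels_left_zero r \<longleftrightarrow> labels_left_zero s"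
    using invariants_if_tgs_isomorphic(2)[OF cong fin iso] invariants_if_tgs_isomorphic(2)[OF cong(2,1) fin]
    unfolding has_left_zero_H5_quotient[OF cong(1)] has_left_zero_H5_quotient[OF cong(2)] by blast
  then show ?thesis
    using invariants_if_tgs_isomorphic(1)[OF cong fin iso]
    by (simp add: labels_kind_def card_quotient_label_rel)
qed

lemma core_isomorphic_if_same_kind:
  assumes rs: "r \<in> set proper_labels" "s \<in> set proper_labels" "labels_kind r = labels_kind s"
  shows "core_isomorphic (X // label_rel r) (core_quotient H5 (label_rel r))
    (X // label_rel s) (core_quotient H5 (label_rel s))"
proof (cases "r = s")
  case True
  then show ?thesis by (simp add: core_isomorphic_refl)
next
  case False
  have cong: "diagonal_congruence X H5 (label_rel r)" "diagonal_congruence X H5 (label_rel s)"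
    using rs by (auto intro!: diagonal_congruence_H5 simp: proper_diagonal_H5)
  show ?thesis
  proof (rule core_isomorphic_quotients[OF cong bij_betw_swap])
    have "\<forall>a\<in>X. \<forall>b\<in>X. r ! (a - 1) = r ! (b - 1) \<longleftrightarrow> s ! (swap a - 1) = s ! (swap b - 1)"
      using same_kind_cases[rule_format, OF rs] False unfolding X_def by blast
    moreover have "swap a \<in> X" if "a \<in> X" for a
      using that bij_betw_swap by (rule bij_betw_apply[rotated])
    ultimately show "(a, b) \<in> label_rel r \<longleftrightarrow> (swap a, swap b) \<in> label_rel s"
      if "a \<in> X" "b \<in> X" for a b
      using that by (simp add: label_rel_def)
  qed (rule swap_H5)
qed

text \<open>\<open>H\<^sub>5\<close> is built from addition in \<open>\<int>\<^sub>2\<close>, twisted by exceptional values at \<open>1\<close> and \<open>2\<close>. The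
  binary operations keep an exception only where the quotient still sees it, and \<open>c\<close> shifts the
  parity so that the exceptional idempotent is neutral.\<close>

definition collapse_op :: "bool \<Rightarrow> bool \<Rightarrow> bit \<Rightarrow> nat \<Rightarrow> nat \<Rightarrow> nat" where
  "collapse_op p q c x y =
     (if p \<and> x = 1 \<and> y = 1 then 1 else if q \<and> x = 2 \<and> y = 2 then 2 else eta (c + eps x + eps y))"

definition labels_collapse :: "nat list \<Rightarrow> (nat \<Rightarrow> nat \<Rightarrow> nat) \<Rightarrow> bool" where
  "labels_collapse r m \<longleftrightarrow>
     (\<forall>a\<in>{1, 2, 3, 4}. \<forall>b\<in>{1, 2, 3, 4}. r ! (a - 1) = r ! (b - 1) \<longrightarrow>
        (\<forall>c\<in>{1, 2, 3, 4}. r ! (m a c - 1) = r ! (m b c - 1) \<and> r ! (m c a - 1) = r ! (m c b - 1))) \<and>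
     (\<forall>a\<in>{1, 2, 3, 4}. \<forall>b\<in>{1, 2, 3, 4}. \<forall>c\<in>{1, 2, 3, 4}.
        r ! (m (m a b) c - 1) = r ! (m a (m b c) - 1) \<and>
        (\<forall>d\<in>{1, 2, 3, 4}. \<forall>e\<in>{1, 2, 3, 4}.
           r ! (m (m (m (m a b) c) d) e - 1) = r ! (H5 a b c d e - 1)))"

text \<open>The flag \<open>p\<close> is set exactly when {1} is a block, and \<open>q\<close>
  exactly when {2} is one. The constant \<open>c\<close> enters a fivefold product four times and
  cancels. It must be 1 for \<mu>: there parity stays visible, and 2 * 2 = 2 forces c + 1 + 1 = 1.
  For \<lambda>, 1 * 1 = 1 forces c = 0.\<close>

lemma labels_collapse_proper:
  "\<forall>(r, p, q, c)\<in>set [([1, 1, 1, 1], False, False, 0), ([1, 2, 1, 1], False, True, 0),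
      ([1, 2, 2, 1], False, False, 0), ([1, 2, 2, 2], True, False, 0), ([1, 2, 2, 4], True, False, 0),
      ([1, 2, 3, 1], False, True, 1), ([1, 2, 3, 3], True, True, 0)].
     labels_collapse r (collapse_op p q c)"
  by code_simp

lemma ex_atomic_binary_collapse_H5_quotient:
  assumes "r \<in> set proper_labels"
  shows "\<exists>s. atomic_binary_collapse (X // label_rel r) (core_quotient H5 (label_rel r)) s"
proof -
  obtain p q c where m: "labels_collapse r (collapse_op p q c)"
    using labels_collapse_proper assms unfolding proper_labels_def by auto
  let ?m = "collapse_op p q c"
  have mX: "?m a b \<in> X" for a b
    by (auto simp: collapse_op_def X_def eta_def)
  interpret diagonal_congruence X H5 "label_rel r"
    using assms by (intro diagonal_congruence_H5) (simp add: proper_diagonal_H5)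
  note m' = m[unfolded labels_collapse_def X_def[symmetric]]
  have cong: "(?m a x, ?m b x) \<in> label_rel r" "(?m x a, ?m x b) \<in> label_rel r"
    if "(a, b) \<in> label_rel r" "x \<in> X" for a b x
    using m' that mX unfolding label_rel_def by blast+
  show ?thesis
  proof (rule ex_atomic_binary_collapse[of ?m])
    fix a a' b b' assume "(a, a') \<in> label_rel r" "(b, b') \<in> label_rel r"
    then have "(?m a b, ?m a' b) \<in> label_rel r" "(?m a' b, ?m a' b') \<in> label_rel r"
      by (auto intro!: cong) (auto simp: label_rel_def)
    then show "(?m a b, ?m a' b') \<in> label_rel r" by (rule equiv_transD[OF equiv])
  next
    fix a b c assume "a \<in> X" "b \<in> X" "c \<in> X"
    then show "(?m (?m a b) c, ?m a (?m b c)) \<in> label_rel r"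
      using m' mX unfolding label_rel_def by blast
  next
    fix a b c d e assume "a \<in> X" "b \<in> X" "c \<in> X" "d \<in> X" "e \<in> X"
    then show "(?m (?m (?m (?m a b) c) d) e, H5 a b c d e) \<in> label_rel r"
      using m' mX H5_in_X unfolding label_rel_def by blast
  qed (rule mX)
qed

section \<open>The five isomorphism types\<close>

text \<open>The implications form a cycle: equal kinds give isomorphic cores, these give isomorphic
  quotient complexes, and these have equal kinds.\<close>

lemma tgs_isomorphic_H5_iff:
  assumes "r \<in> set proper_labels" "s \<in> set proper_labels"
  shows "tgs_isomorphic (diagonal_quotient X H5 (label_rel r)) (diagonal_quotient X H5 (label_rel s))
      \<longleftrightarrow> labels_kind r = labels_kind s"
    "core_isomorphic (X // label_rel r) (core_quotient H5 (label_rel r))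
      (X // label_rel s) (core_quotient H5 (label_rel s)) \<longleftrightarrow> labels_kind r = labels_kind s"
proof -
  have cong: "diagonal_congruence X H5 (label_rel r)" "diagonal_congruence X H5 (label_rel s)"
    using assms by (auto intro!: diagonal_congruence_H5 simp: proper_diagonal_H5)
  note facts = tgs_isomorphic_if_core_isomorphic[OF cong] same_kind_if_tgs_isomorphic[OF assms]
    core_isomorphic_if_same_kind[OF assms]
  show "tgs_isomorphic (diagonal_quotient X H5 (label_rel r)) (diagonal_quotient X H5 (label_rel s))
      \<longleftrightarrow> labels_kind r = labels_kind s"
    "core_isomorphic (X // label_rel r) (core_quotient H5 (label_rel r))
      (X // label_rel s) (core_quotient H5 (label_rel s)) \<longleftrightarrow> labels_kind r = labels_kind s"
    using facts by blast+
qed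

text \<open>Members of one class produce the same filtered list, so duplicates disappear when the
  outer list becomes a set.\<close>

lemma kind_classes:
  "map (\<lambda>r. filter (\<lambda>s. labels_kind r = labels_kind s) proper_labels) proper_labels =
    [[[1, 1, 1, 1]], [[1, 2, 1, 1], [1, 2, 2, 2]], [[1, 2, 2, 1]], [[1, 2, 1, 1], [1, 2, 2, 2]],
     [[1, 2, 2, 4], [1, 2, 3, 1]], [[1, 2, 2, 4], [1, 2, 3, 1]], [[1, 2, 3, 3]]]"
  by code_simp

lemma isomorphism_classes_H5:
  "proper_diagonal X H5 // {(\<theta>, \<theta>'). \<theta> \<in> proper_diagonal X H5 \<and> \<theta>' \<in> proper_diagonal X H5 \<and>
      tgs_isomorphic (diagonal_quotient X H5 \<theta>) (diagonal_quotient X H5 \<theta>')}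
    = {{eq_nabla}, {eq_alpha, eq_beta}, {eq_pi}, {eq_lambda, eq_mu}, {eq_nu}}" (is "?P // ?R = _")
proof -
  have cls: "?R `` {label_rel r} = label_rel ` set (filter (\<lambda>s. labels_kind r = labels_kind s) proper_labels)"
    if "r \<in> set proper_labels" for r
    using that tgs_isomorphic_H5_iff(1) by (auto simp: proper_diagonal_H5)
  have "?P // ?R = (\<lambda>\<theta>. ?R `` {\<theta>}) ` label_rel ` set proper_labels"
    unfolding quotient_image by (simp only: proper_diagonal_H5)
  also have "\<dots> = (\<lambda>r. label_rel ` set (filter (\<lambda>s. labels_kind r = labels_kind s) proper_labels)) ` set proper_labels"
    unfolding image_image by (intro image_cong refl cls)
  also have "\<dots> = (\<lambda>S. label_rel ` set S) `
      set (map (\<lambda>r. filter (\<lambda>s. labels_kind r = labels_kind s) proper_labels) proper_labels)"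
    by (simp only: set_map image_image)
  also have "\<dots> = {{eq_nabla}, {eq_alpha, eq_beta}, {eq_pi}, {eq_lambda, eq_mu}, {eq_nu}}"
    unfolding kind_classes list.set image_insert image_empty label_rel_named
    by (simp add: insert_commute)
  finally show ?thesis .
qed

text \<open>Distinctness of the five classes is decided on label lists, since
  \<open>label_rel\<close> is injective there.\<close>

lemma card_isomorphism_classes:
  "card {{eq_nabla}, {eq_alpha, eq_beta}, {eq_pi}, {eq_lambda, eq_mu}, {eq_nu}} = 5"
proof -
  let ?C = "[{[1, 1, 1, 1]}, {[1, 2, 1, 1], [1, 2, 2, 2]}, {[1, 2, 2, 1 :: nat]},
    {[1, 2, 2, 4], [1, 2, 3, 1]}, {[1, 2, 3, 3]}]"
  have "inj_on ((`) label_rel) (Pow (set diagonal_labels))"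
    using diagonal_labels_inj by (rule inj_on_image_Pow)
  then have "inj_on ((`) label_rel) (set ?C)"
    by (rule inj_on_subset) (simp add: diagonal_labels_def)
  then have "card ((`) label_rel ` set ?C) = card (set ?C)" by (rule card_image)
  also have "card (set ?C) = 5" by (simp add: doubleton_eq_iff)
  finally show ?thesis
    by (simp only: list.set image_insert image_empty label_rel_named)
qed

theorem corollary7p1:
  shows
    "ternary_gamma_semiring T5 \<and> completely_additive T5 \<and> complete_atomic_boolean T5 \<and>
       atom_total T5
     \<and> card (strong_atom_saturated_pairs X X H5) = 36
     \<and> card (diagonal_pairs X H5) = 8
     \<and> (\<exists>f. bij_betw f (diagonal_pairs X H5) (Pow {1, 2, 3 :: nat}) \<and>
           (\<forall>c\<in>diagonal_pairs X H5. \<forall>d\<in>diagonal_pairs X H5.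
              c \<sqsubseteq>\<^bsub>pair_inclusion_order (diagonal_pairs X H5)\<^esub> d \<longleftrightarrow> f c \<subseteq> f d))
     \<and> card {c. is_atom (pair_inclusion_order (diagonal_pairs X H5)) c} = 3
     \<and> \<not> (\<exists>s. atomic_binary_collapse X H5 s)
     \<and> (\<forall>\<theta>\<in>proper_diagonal X H5.
           (\<exists>f. tgs_iso f f (diagonal_quotient X H5 \<theta>)
                  (powerset_complex (X // \<theta>) (X // \<theta>) (core_quotient H5 \<theta>))) \<and>
           (\<exists>s. atomic_binary_collapse (X // \<theta>) (core_quotient H5 \<theta>) s))
     \<and> proper_diagonal X H5 //
           {(\<theta>, \<theta>'). \<theta> \<in> proper_diagonal X H5 \<and> \<theta>' \<in> proper_diagonal X H5 \<and>
              tgs_isomorphic (diagonal_quotient X H5 \<theta>) (diagonal_quotient X H5 \<theta>')}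
         = {{eq_nabla}, {eq_alpha, eq_beta}, {eq_pi}, {eq_lambda, eq_mu}, {eq_nu}}
     \<and> card {{eq_nabla}, {eq_alpha, eq_beta}, {eq_pi}, {eq_lambda, eq_mu}, {eq_nu}} = 5
     \<and> (\<forall>\<theta>\<in>proper_diagonal X H5. \<forall>\<theta>'\<in>proper_diagonal X H5.
           tgs_isomorphic (diagonal_quotient X H5 \<theta>) (diagonal_quotient X H5 \<theta>') \<longleftrightarrow>
           core_isomorphic (X // \<theta>) (core_quotient H5 \<theta>) (X // \<theta>') (core_quotient H5 \<theta>'))"
proof (intro conjI ballI)
  show "ternary_gamma_semiring T5"
    unfolding T5_def by (rule ternary_gamma_semiring_powerset_complex[OF H5_in_X H5_assoc])
  show "completely_additive T5"
    unfolding T5_def by (rule completely_additive_powerset_complex[OF H5_in_X])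
  show "complete_atomic_boolean T5"
    unfolding T5_def by (rule complete_atomic_boolean_powerset_complex)
  show "atom_total T5"
    unfolding T5_def by (rule atom_total_powerset_complex[OF H5_in_X])
  obtain f where f: "bij_betw f (diagonal_pairs X H5) (Pow {1, 2, 3 :: nat})"
    "\<forall>c\<in>diagonal_pairs X H5. \<forall>d\<in>diagonal_pairs X H5.
      c \<sqsubseteq>\<^bsub>pair_inclusion_order (diagonal_pairs X H5)\<^esub> d \<longleftrightarrow> f c \<subseteq> f d"
    using diagonal_lattice by blast
  show "card (diagonal_pairs X H5) = 8"
    using bij_betw_same_card[OF f(1)] by (simp add: card_Pow)
  have "card ((\<lambda>b. {b}) ` {1, 2, 3 :: nat}) = 3" by (subst card_image) simp_all
  then show "card {c. is_atom (pair_inclusion_order (diagonal_pairs X H5)) c} = 3"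
    using bij_betw_same_card[OF bij_betw_atoms[OF f]] by simp
  show "\<not> (\<exists>s. atomic_binary_collapse X H5 s)"
    using no_atomic_binary_collapse_H5 by blast
next
  fix \<theta> assume \<theta>: "\<theta> \<in> proper_diagonal X H5"
  show "\<exists>f. tgs_iso f f (diagonal_quotient X H5 \<theta>)
      (powerset_complex (X // \<theta>) (X // \<theta>) (core_quotient H5 \<theta>))"
    using diagonal_congruence_H5[OF \<theta>] by (rule diagonal_congruence.tgs_iso_diagonal_quotient)
  show "\<exists>s. atomic_binary_collapse (X // \<theta>) (core_quotient H5 \<theta>) s"
    using \<theta> ex_atomic_binary_collapse_H5_quotient by (auto simp: proper_diagonal_H5)
  fix \<theta>' assume "\<theta>' \<in> proper_diagonal X H5"
  with \<theta> show "tgs_isomorphic (diagonal_quotient X H5 \<theta>) (diagonal_quotient X H5 \<theta>') \<longleftrightarrow>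
      core_isomorphic (X // \<theta>) (core_quotient H5 \<theta>) (X // \<theta>') (core_quotient H5 \<theta>')"
    using tgs_isomorphic_H5_iff by (auto simp: proper_diagonal_H5)
qed (rule card_strong_atom_saturated_pairs_H5 diagonal_lattice isomorphism_classes_H5
    card_isomorphism_classes)+

end
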